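(* Let $1<q<2$ and $p=q/(q-1)$. A compact set $E\subset\mathbb{T}$ supports no nontrivial (nonzero) complex finite Borel measure $\mu$ with $\{\widehat{\mu}(n)\}_{n\in\mathbb{Z}}\in\ell^q$ if and only if $\mathrm{Cap}_{\ell^p}(E)=0$. Moreover, for every compact set $E\subset\mathbb{T}$, $$\mathrm{Cap}_{\ell^p}(E)=\sup_{\substack{\nu\in M(E)\\ \|\nu\|_{A_q}\le 1}}|\nu(E)|.$$
   Context: $\mathbb{T}$ is the unit circle. $M(E)$ denotes the set of complex Borel measures of finite total variation on $\mathbb{T}$ with support in $E$; for a measure $\mu$, $\widehat{\mu}(n)=\int_{\mathbb{T}}\zeta^{-n}\,d\mu(\zeta)$. For $1\le s<\infty$, $A_s(\mathbb{T})$ is the space of distributions $S$ on $\mathbb{T}$ whose Fourier coefficients satisfy $\{\widehat{S}(n)\}_{n\in\mathbb{Z}}\in\ell^s=\ell^s(\mathbb{Z})$, with norm $\|S\|_{A_s}=\|\{\widehat{S}(n)\}_{n\in\mathbb{Z}}\|_{\ell^s}$ (and $\|S\|_{A_s}=\infty$ if $S\notin A_s(\mathbb{T})$). Fourier coefficients of functions are taken with respect to normalized Lebesgue measure. $C(\mathbb{T})$ is the space of continuous functions on $\mathbb{T}$. The $\ell^p$-capacity is $$\mathrm{Cap}_{\ell^p}(E)=\inf\{\|\phi\|_{A_p}:\ \phi\in C(\mathbb{T}),\ \phi=1\text{ on }E\}.$$ *)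

theory Defs
  imports "HOL-Analysis.Analysis"
begin

section \<open>Complex measures\<close>

text \<open>
  A complex measure on the measurable space M is a set function on the sets of M; its values on
  other sets carry no information. Countable additivity forces the value 0 on the empty set.
\<close>

definition complex_measure :: "'a measure \<Rightarrow> ('a set \<Rightarrow> complex) \<Rightarrow> bool" where
  "complex_measure M \<mu> \<longleftrightarrow>
     (\<forall>A :: nat \<Rightarrow> 'a set. range A \<subseteq> sets M \<longrightarrow> disjoint_family A \<longrightarrow>
        (\<lambda>i. \<mu> (A i)) sums \<mu> (\<Union>i. A i))"

definition total_variation :: "'a measure \<Rightarrow> ('a set \<Rightarrow> complex) \<Rightarrow> 'a set \<Rightarrow> ennreal" where
  "total_variation M \<mu> A =
     (SUP P \<in> {P :: nat \<Rightarrow> 'a set. range P \<subseteq> sets M \<and> disjoint_family P \<and> (\<Union>i. P i) = A}.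
        \<Sum>i. ennreal (norm (\<mu> (P i))))"

text \<open>
  The positive part in the Jordan decomposition of a real signed measure. The function
  \<^const>\<open>ennreal\<close> maps negative reals to 0, which does not affect the supremum
  because of the term for the empty set.
\<close>

definition positive_part :: "'a measure \<Rightarrow> ('a set \<Rightarrow> real) \<Rightarrow> 'a measure" where
  "positive_part M \<nu> =
     measure_of (space M) (sets M) (\<lambda>A. SUP B \<in> {B \<in> sets M. B \<subseteq> A}. ennreal (\<nu> B))"

definition signed_integral :: "'a measure \<Rightarrow> ('a set \<Rightarrow> real) \<Rightarrow> ('a \<Rightarrow> complex) \<Rightarrow> complex" where
  "signed_integral M \<nu> f =
     (LINT x|positive_part M \<nu>. f x) - (LINT x|positive_part M (\<lambda>A. - \<nu> A). f x)"

definition complex_integral :: "'a measure \<Rightarrow> ('a set \<Rightarrow> complex) \<Rightarrow> ('a \<Rightarrow> complex) \<Rightarrow> complex" where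
  "complex_integral M \<mu> f =
     signed_integral M (\<lambda>A. Re (\<mu> A)) f + \<i> * signed_integral M (\<lambda>A. Im (\<mu> A)) f"

section \<open>The unit circle\<close>

abbreviation circle :: "complex set" where
  "circle \<equiv> sphere 0 1"

definition circle_borel :: "complex measure" where
  "circle_borel = restrict_space borel circle"

definition circle_lebesgue :: "complex measure" where
  "circle_lebesgue = distr (uniform_measure lborel {0..<2 * pi}) circle_borel cis"

definition measure_support :: "(complex set \<Rightarrow> complex) \<Rightarrow> complex set" where
  "measure_support \<mu> =
     {z \<in> circle. \<forall>U. open U \<longrightarrow> z \<in> U \<longrightarrow> total_variation circle_borel \<mu> (U \<inter> circle) \<noteq> 0}"

definition measures_on :: "complex set \<Rightarrow> (complex set \<Rightarrow> complex) set" where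
  "measures_on E =
     {\<mu>. complex_measure circle_borel \<mu> \<and> total_variation circle_borel \<mu> circle < \<infinity> \<and>
         measure_support \<mu> \<subseteq> E}"

definition nonzero_measure :: "(complex set \<Rightarrow> complex) \<Rightarrow> bool" where
  "nonzero_measure \<mu> \<longleftrightarrow> (\<exists>A \<in> sets circle_borel. \<mu> A \<noteq> 0)"

section \<open>Fourier coefficients and the spaces \<open>A\<^sub>s\<close>\<close>

definition lp_space :: "real \<Rightarrow> (int \<Rightarrow> complex) set" where
  "lp_space s = {a. (\<lambda>n. norm (a n) powr s) summable_on UNIV}"

definition lp_norm :: "real \<Rightarrow> (int \<Rightarrow> complex) \<Rightarrow> ennreal" where
  "lp_norm s a =
     (if a \<in> lp_space s then ennreal ((\<Sum>\<^sub>\<infinity>n. norm (a n) powr s) powr (1 / s)) else \<infinity>)"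

text \<open>
  Distributions are represented by the functionals they induce on test functions. Only the
  distributions induced by continuous functions and by complex measures occur below, so
  continuity of the functional on smooth functions never has to be imposed separately.
\<close>

type_synonym functional = "(complex \<Rightarrow> complex) \<Rightarrow> complex"

definition function_distribution :: "(complex \<Rightarrow> complex) \<Rightarrow> functional" where
  "function_distribution \<phi> = (\<lambda>f. LINT z|circle_lebesgue. f z * \<phi> z)"

definition measure_distribution :: "(complex set \<Rightarrow> complex) \<Rightarrow> functional" where
  "measure_distribution \<mu> = (\<lambda>f. complex_integral circle_borel \<mu> f)"

definition fourier_coeff :: "functional \<Rightarrow> int \<Rightarrow> complex" where
  "fourier_coeff S n = S (\<lambda>z. z powi (- n))"

definition A_norm :: "real \<Rightarrow> functional \<Rightarrow> ennreal" where
  "A_norm s S = lp_norm s (fourier_coeff S)"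

definition lp_capacity :: "real \<Rightarrow> complex set \<Rightarrow> ennreal" where
  "lp_capacity p E =
     (INF \<phi> \<in> {\<phi>. continuous_on circle \<phi> \<and> (\<forall>z\<in>E. \<phi> z = 1)}. A_norm p (function_distribution \<phi>))"

end

theory Submission
  imports Defs
begin

text \<open>
  The capacity is the distance in \<open>\<ell>\<^sup>p\<close> from the origin to the convex set of
  Fourier transforms of continuous functions that are \<open>1\<close> on \<open>E\<close>, and the
  formula for it is the duality between distances and functionals in \<open>\<ell>\<^sup>q\<close>.
  What has to be shown is that the extremal functional is a measure carried by \<open>E\<close>.
  Since \<open>q < 2 < p\<close>, this comes from square-summability.

  For the lower bound on the capacity, let \<open>\<nu>\<close> be a measure on \<open>E\<close>
  with Fourier coefficients in \<open>\<ell>\<^sup>q\<close> and let \<open>\<phi>\<close> be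
  admissible, that is, continuous with value \<open>1\<close> on \<open>E\<close>. Then \<open>\<nu>
  E = \<integral> \<phi> d\<nu>\<close>, because \<open>\<nu>\<close> vanishes off \<open>E\<close>.
  The coefficients lie in \<open>\<ell>\<^sup>2\<close>, so Parseval's formula
  \<open>complex_integral_eq_pairing\<close> holds: both sides are bounded by the supremum of
  \<open>\<phi>\<close> and agree on trigonometric polynomials. Hoelder's inequality concludes.

  For the upper bound, \<open>lp_separation\<close> yields a sequence \<open>b\<close> in the unit
  ball of \<open>\<ell>\<^sup>q\<close> whose pairing with the transform of each admissible function
  has real part at least the capacity. Because \<open>b\<close> is square-summable and Bessel's
  inequality holds, the pairing is defined on indicators and bounded there in mean square, so it
  defines a complex measure (\<open>finite_complex_measure_pairing_measure\<close>). It annihilates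
  continuous functions that vanish on \<open>E\<close>, because those can be added to admissible
  functions with any factor. Hence it lives on \<open>E\<close>, and it is extremal
  (\<open>extremal_measure\<close>).

  The criterion for capacity zero follows in one direction from the extremal measure. In the other,
  the estimate of the second paragraph, applied to \<open>z powi k * \<phi> z\<close> for all
  \<open>k\<close>, shows that a measure on \<open>E\<close> with coefficients in
  \<open>\<ell>\<^sup>q\<close> has only zero coefficients if the capacity is zero
  (\<open>capacity_0_imp_measure_0\<close>).
\<close>

section \<open>Sequences in \<open>\<ell>\<^sup>s\<close>\<close>

text \<open>
  The \<open>s\<close>-th power of the norm is used instead of the norm itself, because the
  minimisation below is about the power, which is convex and has an explicit derivative.
\<close>

definition power_sum :: "real \<Rightarrow> (int \<Rightarrow> complex) \<Rightarrow> real" where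
  "power_sum s a = (\<Sum>\<^sub>\<infinity>n. norm (a n) powr s)"

lemma power_sum_nonneg: "0 \<le> power_sum s a"
  unfolding power_sum_def by (intro infsum_nonneg) simp

lemma finite_sum_le_power_sum:
  assumes "a \<in> lp_space s" "finite F"
  shows "(\<Sum>n\<in>F. norm (a n) powr s) \<le> power_sum s a"
  using assms unfolding power_sum_def lp_space_def by (intro finite_sum_le_infsum) auto

lemma coordinate_le_power_sum:
  assumes "a \<in> lp_space s"
  shows "norm (a n) powr s \<le> power_sum s a"
  using finite_sum_le_power_sum[OF assms, of "{n}"] by simp

lemma lp_space_from_finite_sums:
  assumes "\<And>F. finite F \<Longrightarrow> (\<Sum>n\<in>F. norm (a n) powr s) \<le> C"
  shows "a \<in> lp_space s" "power_sum s a \<le> C"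
proof -
  have "(\<lambda>n. norm (a n) powr s) summable_on UNIV"
    by (rule nonneg_bdd_above_summable_on) (auto intro!: bdd_aboveI2[where M=C] assms)
  then show "a \<in> lp_space s" by (simp add: lp_space_def)
  with \<open>_ summable_on UNIV\<close> show "power_sum s a \<le> C" unfolding power_sum_def
    by (intro infsum_le_finite_sums) (auto intro: assms)
qed

text \<open>
  Every entry is bounded by the norm, so the surplus exponent \<open>t - s\<close> costs only a
  constant factor. In this form \<open>\<ell>\<^sup>q \<subseteq> \<ell>\<^sup>2 \<subseteq>
  \<ell>\<^sup>p\<close> for \<open>q < 2 < p\<close>, which ties the problem to square-summable
  sequences and hence to the Bessel inequality.
\<close>

lemma lp_space_mono:
  assumes "0 < s" "s \<le> t" "a \<in> lp_space s"
  shows "a \<in> lp_space t"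
proof (rule lp_space_from_finite_sums(1))
  fix F :: "int set" assume F: "finite F"
  let ?P = "power_sum s a"
  have "norm (a n) powr t \<le> norm (a n) powr s * ?P powr ((t - s) / s)" for n
  proof -
    have "norm (a n) powr t = norm (a n) powr s * (norm (a n) powr s) powr ((t - s) / s)"
      using assms by (simp add: powr_powr powr_add[symmetric])
    also have "\<dots> \<le> norm (a n) powr s * ?P powr ((t - s) / s)"
      using assms by (intro mult_left_mono powr_mono2 coordinate_le_power_sum) auto
    finally show ?thesis .
  qed
  then have "(\<Sum>n\<in>F. norm (a n) powr t) \<le> (\<Sum>n\<in>F. norm (a n) powr s) * ?P powr ((t - s) / s)"
    unfolding sum_distrib_right by (rule sum_mono)
  also have "\<dots> \<le> ?P * ?P powr ((t - s) / s)"
    using finite_sum_le_power_sum[OF assms(3) F] by (intro mult_right_mono) auto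
  finally show "(\<Sum>n\<in>F. norm (a n) powr t) \<le> ?P * ?P powr ((t - s) / s)" .
qed

text \<open>
  Fatou's lemma for sums: each finite partial sum passes to the limit.
\<close>

lemma power_sum_fatou:
  assumes "0 < s" "\<And>j. x j \<in> lp_space s" "\<And>j. power_sum s (x j) \<le> C j" "C \<longlonglongrightarrow> c"
    and "\<And>n. (\<lambda>j. x j n) \<longlonglongrightarrow> y n"
  shows "y \<in> lp_space s" "power_sum s y \<le> c"
proof -
  have "(\<Sum>n\<in>F. norm (y n) powr s) \<le> c" if "finite F" for F
  proof (rule LIMSEQ_le[OF _ assms(4)])
    show "(\<lambda>j. \<Sum>n\<in>F. norm (x j n) powr s) \<longlonglongrightarrow> (\<Sum>n\<in>F. norm (y n) powr s)"
      using assms(1) by (intro tendsto_sum tendsto_powr' tendsto_norm assms(5)) auto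
    show "\<exists>N. \<forall>j\<ge>N. (\<Sum>n\<in>F. norm (x j n) powr s) \<le> C j"
      using finite_sum_le_power_sum[OF assms(2) that] assms(3) order_trans by blast
  qed
  then show "y \<in> lp_space s" "power_sum s y \<le> c"
    using lp_space_from_finite_sums by blast+
qed

lemma Young_power_sum:
  assumes "p > 1" "q > 1" "1 / p + 1 / q = 1" "x \<in> lp_space q" "w \<in> lp_space p"
  shows "(\<lambda>n. norm (x n * w n)) summable_on UNIV"
    and "(\<Sum>\<^sub>\<infinity>n. norm (x n * w n)) \<le> power_sum q x / q + power_sum p w / p"
proof -
  have y: "norm (x n * w n) \<le> norm (x n) powr q / q + norm (w n) powr p / p" for n
    using Youngs_inequality[of p q "norm (w n)" "norm (x n)"] assms
    by (simp add: norm_mult mult.commute add.commute)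
  have s: "(\<lambda>n. norm (x n) powr q / q) summable_on UNIV" "(\<lambda>n. norm (w n) powr p / p) summable_on UNIV"
    using assms(4,5) by (auto simp: lp_space_def divide_inverse intro: summable_on_cmult_left)
  then show a: "(\<lambda>n. norm (x n * w n)) summable_on UNIV"
    using y by (intro Infinite_Sum.abs_summable_on_comparison_test'[OF summable_on_add[OF s]]) auto
  have "(\<Sum>\<^sub>\<infinity>n. norm (x n * w n)) \<le> (\<Sum>\<^sub>\<infinity>n. norm (x n) powr q / q + norm (w n) powr p / p)"
    using a y s by (intro infsum_mono summable_on_add) auto
  also have "\<dots> = power_sum q x / q + power_sum p w / p"
    using s assms(4,5) unfolding power_sum_def lp_space_def
    by (simp add: infsum_add divide_inverse infsum_cmult_left')
  finally show "(\<Sum>\<^sub>\<infinity>n. norm (x n * w n)) \<le> power_sum q x / q + power_sum p w / p" .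
qed

lemma lp_space_scale:
  assumes "a \<in> lp_space s"
  shows "(\<lambda>n. c * a n) \<in> lp_space s" "power_sum s (\<lambda>n. c * a n) = norm c powr s * power_sum s a"
  using assms unfolding lp_space_def power_sum_def
  by (auto simp: norm_mult powr_mult infsum_cmult_right' intro: summable_on_cmult_right)

text \<open>
  Young's inequality, applied after scaling both norms to at most one. Stating it with upper bounds
  \<open>X\<close> and \<open>W\<close> for the two norms avoids a separate treatment of vanishing
  norms.
\<close>

lemma Holder_power_sum:
  assumes "p > 1" "q > 1" "1 / p + 1 / q = 1" "x \<in> lp_space q" "w \<in> lp_space p"
    and "0 < X" "0 < W" "power_sum q x \<le> X powr q" "power_sum p w \<le> W powr p"
  shows "norm (\<Sum>\<^sub>\<infinity>n. x n * w n) \<le> X * W"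
proof -
  let ?x = "\<lambda>n. of_real (1 / X) * x n" and ?w = "\<lambda>n. of_real (1 / W) * w n"
  note sc = lp_space_scale(1)[OF assms(4), of "of_real (1/X)"] lp_space_scale(1)[OF assms(5), of "of_real (1/W)"]
  have "(\<Sum>\<^sub>\<infinity>n. norm (x n * w n)) = (\<Sum>\<^sub>\<infinity>n. (X * W) * norm (?x n * ?w n))"
    using assms by (intro infsum_cong) (simp add: norm_mult norm_divide)
  also have "\<dots> = (X * W) * (\<Sum>\<^sub>\<infinity>n. norm (?x n * ?w n))" by (rule infsum_cmult_right')
  also have "\<dots> \<le> (X * W) * (power_sum q ?x / q + power_sum p ?w / p)"
    using assms Young_power_sum(2)[OF assms(1-3) sc] by (intro mult_left_mono) auto
  also have "\<dots> \<le> (X * W) * (1 / q + 1 / p)"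
    using assms lp_space_scale(2)[OF assms(4), of "of_real (1/X)"] lp_space_scale(2)[OF assms(5), of "of_real (1/W)"]
    by (intro mult_left_mono add_mono divide_right_mono) (auto simp: norm_divide powr_divide)
  also have "\<dots> = X * W" using assms(3) by (simp add: add.commute)
  finally show ?thesis
    using norm_infsum_bound[OF Young_power_sum(1)[OF assms(1-5)]] by linarith
qed

lemma Holder_inequality:
  assumes "p > 1" "q > 1" "1 / p + 1 / q = 1" "x \<in> lp_space q" "w \<in> lp_space p"
  shows "norm (\<Sum>\<^sub>\<infinity>n. x n * w n) \<le> power_sum q x powr (1/q) * power_sum p w powr (1/p)"
proof -
  let ?X = "\<lambda>e. (power_sum q x + e) powr (1/q)" and ?W = "\<lambda>e. (power_sum p w + e) powr (1/p)"
  have "((\<lambda>e. ?X e * ?W e) \<longlongrightarrow> (power_sum q x + 0) powr (1/q) * (power_sum p w + 0) powr (1/p)) (at_right 0)"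
    using assms power_sum_nonneg[of q x] power_sum_nonneg[of p w]
    by (intro tendsto_intros tendsto_powr') (auto simp: eventually_at_right_less intro!: eventually_mono[OF eventually_at_right_less[of 0]])
  moreover have "eventually (\<lambda>e. norm (\<Sum>\<^sub>\<infinity>n. x n * w n) \<le> ?X e * ?W e) (at_right 0)"
    using eventually_at_right_less[of "0::real"]
  proof eventually_elim
    case (elim e)
    then show ?case
      using assms power_sum_nonneg[of q x] power_sum_nonneg[of p w]
      by (intro Holder_power_sum[OF assms]) (auto simp: powr_powr)
  qed
  ultimately show ?thesis
    by (intro tendsto_lowerbound[of _ _ "at_right 0"]) auto
qed

text \<open>
  Norm-bounded pointwise convergence implies weak convergence: outside a finite set of indices the
  pairing is uniformly small because \<open>w\<close> has a small tail there, and on the finite set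
  pointwise convergence suffices.
\<close>

lemma lp_pairing_tendsto:
  assumes "p > 1" "q > 1" "1 / p + 1 / q = 1" and w: "w \<in> lp_space p"
    and x: "\<And>j. x j \<in> lp_space q" "\<And>j. power_sum q (x j) \<le> C"
    and lim: "\<And>n. (\<lambda>j. x j n) \<longlonglongrightarrow> y n"
  shows "(\<lambda>j. \<Sum>\<^sub>\<infinity>n. x j n * w n) \<longlonglongrightarrow> (\<Sum>\<^sub>\<infinity>n. y n * w n)"
proof (rule LIMSEQ_I)
  fix e :: real assume e: "0 < e"
  have C: "0 \<le> C" using power_sum_nonneg[of q "x 0"] x(2)[of 0] by linarith
  have y: "y \<in> lp_space q" "power_sum q y \<le> C"
    using power_sum_fatou[where s=q and x=x and C="\<lambda>_. C" and c=C and y=y] x lim assms(2) by auto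
  define X where "X = (C + 1) powr (1 / q)"
  have X: "0 < X" "C \<le> X powr q" using C assms(2) by (auto simp: X_def powr_powr)
  define W where "W = e / (4 * X)"
  have W: "0 < W" using e X by (simp add: W_def)
  obtain F where F: "finite F" "dist (\<Sum>n\<in>F. norm (w n) powr p) (power_sum p w) \<le> W powr p"
    using infsum_finite_approximation[of "\<lambda>n. norm (w n) powr p" UNIV "W powr p"] w W
    unfolding lp_space_def power_sum_def by auto
  define w' where "w' = (\<lambda>n. if n \<in> F then 0 else w n)"
  have w': "w' \<in> lp_space p" "power_sum p w' \<le> W powr p"
  proof -
    have "(\<Sum>n\<in>G. norm (w' n) powr p) \<le> W powr p" if G: "finite G" for G
    proof -
      have "(\<Sum>n\<in>G. norm (w' n) powr p) = (\<Sum>n\<in>G - F. norm (w n) powr p)"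
        using G by (intro sum.mono_neutral_cong_right) (auto simp: w'_def)
      also have "\<dots> = (\<Sum>n\<in>G \<union> F. norm (w n) powr p) - (\<Sum>n\<in>F. norm (w n) powr p)"
        using G F sum_diff[of "G \<union> F" F "\<lambda>n. norm (w n) powr p"] by (simp add: Un_Diff)
      also have "\<dots> \<le> power_sum p w - (\<Sum>n\<in>F. norm (w n) powr p)"
        using finite_sum_le_power_sum[OF w] G F by simp
      also have "\<dots> \<le> W powr p" using F by (simp add: dist_real_def)
      finally show ?thesis .
    qed
    then show "w' \<in> lp_space p" "power_sum p w' \<le> W powr p"
      using lp_space_from_finite_sums by blast+
  qed
  have split: "(\<Sum>\<^sub>\<infinity>n. z n * w n) = (\<Sum>n\<in>F. z n * w n) + (\<Sum>\<^sub>\<infinity>n. z n * w' n)" if "z \<in> lp_space q" for z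
  proof -
    have s: "(\<lambda>n. z n * w n) summable_on UNIV" "(\<lambda>n. z n * w' n) summable_on UNIV"
      using Young_power_sum(1)[OF assms(1-3) that w] Young_power_sum(1)[OF assms(1-3) that w'(1)]
      by (auto intro: abs_summable_summable)
    have "(\<Sum>\<^sub>\<infinity>n. z n * w n) = (\<Sum>\<^sub>\<infinity>n\<in>F \<union> -F. z n * w n)" by simp
    also have "\<dots> = (\<Sum>\<^sub>\<infinity>n\<in>F. z n * w n) + (\<Sum>\<^sub>\<infinity>n\<in>-F. z n * w n)"
      using F s by (intro infsum_Un_disjoint) (auto intro: summable_on_subset)
    also have "(\<Sum>\<^sub>\<infinity>n\<in>-F. z n * w n) = (\<Sum>\<^sub>\<infinity>n. z n * w' n)"
      by (rule infsum_cong_neutral) (auto simp: w'_def)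
    finally show ?thesis using F by simp
  qed
  have tail: "norm (\<Sum>\<^sub>\<infinity>n. z n * w' n) \<le> e / 4" if "z \<in> lp_space q" "power_sum q z \<le> C" for z
  proof -
    have "norm (\<Sum>\<^sub>\<infinity>n. z n * w' n) \<le> X * W"
      using that X W w' by (intro Holder_power_sum[OF assms(1-3)]) auto
    then show ?thesis using X by (simp add: W_def)
  qed
  have "(\<lambda>j. \<Sum>n\<in>F. x j n * w n) \<longlonglongrightarrow> (\<Sum>n\<in>F. y n * w n)"
    by (intro tendsto_intros lim)
  from LIMSEQ_D[OF this, of "e / 4"] e obtain N where N: "\<And>j. j \<ge> N \<Longrightarrow> norm ((\<Sum>n\<in>F. x j n * w n) - (\<Sum>n\<in>F. y n * w n)) < e / 4"
    by auto
  have "norm ((\<Sum>\<^sub>\<infinity>n. x j n * w n) - (\<Sum>\<^sub>\<infinity>n. y n * w n)) < e" if "j \<ge> N" for j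
  proof -
    have *: "norm (a + b - (c + d)) < e" if "norm (a - c) < e/4" "norm b \<le> e/4" "norm d \<le> e/4" for a b c d :: complex
    proof -
      have "norm (a + b - (c + d)) = norm ((a - c) + (b - d))" by (simp add: algebra_simps)
      also have "\<dots> \<le> norm (a - c) + (norm b + norm d)"
        by (meson add_left_mono norm_triangle_ineq norm_triangle_ineq4 order_trans)
      finally show ?thesis using that e by linarith
    qed
    show ?thesis unfolding split[OF x(1)] split[OF y(1)]
      by (rule *) (use N[OF that] tail[OF x] tail[OF y] in auto)
  qed
  then show "\<exists>N. \<forall>j\<ge>N. norm ((\<Sum>\<^sub>\<infinity>n. x j n * w n) - (\<Sum>\<^sub>\<infinity>n. y n * w n)) < e" by blast
qed

text \<open>
  A product of countably many discs is compact by Tychonoff's theorem and metrizable, hence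
  sequentially compact.
\<close>

lemma bounded_pointwise_convergent_subsequence:
  fixes x :: "nat \<Rightarrow> int \<Rightarrow> complex"
  assumes "\<And>j n. norm (x j n) \<le> B"
  obtains r y where "strict_mono r" "\<And>n. (\<lambda>j. x (r j) n) \<longlonglongrightarrow> y n"
proof -
  let ?K = "Pi\<^sub>E UNIV (\<lambda>_. cball 0 B) :: (int \<Rightarrow> complex) set"
  have "compactin (product_topology (\<lambda>_. euclidean) UNIV) ?K"
    by (simp add: compactin_PiE)
  then have "compact ?K"
    by (simp add: euclidean_product_topology flip: compactin_euclidean_iff)
  then have "seq_compact ?K" by (rule compact_imp_seq_compact)
  moreover have "\<forall>j. x j \<in> ?K" using assms by auto
  ultimately obtain y r where r: "strict_mono r" "(x \<circ> r) \<longlonglongrightarrow> y"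
    unfolding seq_compact_def by blast
  have "(\<lambda>j. x (r j) n) \<longlonglongrightarrow> y n" for n
  proof -
    have "continuous_on UNIV (\<lambda>f :: int \<Rightarrow> complex. f n)" by simp
    then show ?thesis
      using continuous_on_tendsto_compose[of UNIV "\<lambda>f. f n" "x \<circ> r" y sequentially] r(2) by simp
  qed
  with r(1) that show thesis by blast
qed

section \<open>Separating a convex set from the origin in \<open>\<ell>\<^sup>p\<close>\<close>

text \<open>
  Up to the factor \<open>p\<close> this is the conjugate of the gradient of \<open>z \<mapsto> norm
  z powr p\<close>. Applied to each entry it maps \<open>\<ell>\<^sup>p\<close> to
  \<open>\<ell>\<^sup>q\<close>, and pairing a sequence with its image gives the \<open>p\<close>-th
  power of its norm.
\<close>

definition duality_map :: "real \<Rightarrow> complex \<Rightarrow> complex" where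
  "duality_map p z = cnj (sgn z) * of_real (norm z powr (p - 1))"

lemma norm_duality_map: "norm (duality_map p z) = norm z powr (p - 1)"
  by (cases "z = 0") (simp_all add: duality_map_def norm_mult norm_sgn)

lemma duality_map_mult_self: "duality_map p z * z = of_real (norm z powr p)"
proof (cases "z = 0")
  case False
  then have "cnj (sgn z) * z = of_real (norm z)"
    by (simp add: sgn_eq divide_simps) (simp add: mult.commute complex_norm_square[symmetric] power2_eq_square)
  then have "duality_map p z * z = of_real (norm z * norm z powr (p - 1))"
    by (simp add: duality_map_def mult.assoc mult.left_commute mult.commute)
  also have "norm z * norm z powr (p - 1) = norm z powr p"
    using False powr_add[of "norm z" 1 "p - 1"] by simp
  finally show ?thesis .
qed (simp add: duality_map_def)

lemma tendsto_duality_map: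
  assumes "1 < p" "(f \<longlongrightarrow> z) F"
  shows "((\<lambda>x. duality_map p (f x)) \<longlongrightarrow> duality_map p z) F"
proof (cases "z = 0")
  case True
  have "((\<lambda>x. norm (f x) powr (p - 1)) \<longlongrightarrow> norm z powr (p - 1)) F"
    using assms by (intro tendsto_powr' tendsto_norm) auto
  then have "((\<lambda>x. norm (duality_map p (f x))) \<longlongrightarrow> 0) F"
    using True by (simp add: norm_duality_map)
  then have "((\<lambda>x. duality_map p (f x)) \<longlongrightarrow> 0) F" by (rule tendsto_norm_zero_cancel)
  then show ?thesis using True by (simp add: duality_map_def)
next
  case False
  then show ?thesis unfolding duality_map_def
    using assms by (intro tendsto_intros tendsto_powr' tendsto_norm tendsto_sgn) auto
qed

context
  fixes p q :: real
  assumes pq: "p > 1" "q > 1" "1 / p + 1 / q = 1"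
begin

lemma conjugate_exponent: "(p - 1) * q = p"
proof -
  have "p * q * (1 / p + 1 / q) = p * q" using pq by simp
  moreover have "p * q * (1 / p + 1 / q) = q + p" using pq by (simp add: field_simps)
  ultimately have "q + p = p * q" by simp
  then show ?thesis by (simp add: algebra_simps)
qed

lemma duality_map_power: "norm (duality_map p z) powr q = norm z powr p"
  by (simp add: norm_duality_map powr_powr conjugate_exponent)

lemma duality_map_lp:
  assumes "x \<in> lp_space p"
  shows "(\<lambda>n. duality_map p (x n)) \<in> lp_space q"
    and "power_sum q (\<lambda>n. duality_map p (x n)) = power_sum p x"
  using assms by (simp_all add: lp_space_def power_sum_def duality_map_power)

lemma pairing_duality_map_self:
  assumes "x \<in> lp_space p"
  shows "(\<Sum>\<^sub>\<infinity>n. duality_map p (x n) * x n) = of_real (power_sum p x)"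
  using assms unfolding duality_map_mult_self power_sum_def lp_space_def
  by (intro infsumI has_sum_of_real has_sum_infsum) auto

lemma pairing_linear:
  assumes "b \<in> lp_space q" "x \<in> lp_space p" "y \<in> lp_space p"
  shows "(\<Sum>\<^sub>\<infinity>n. b n * (c * x n + d * y n)) = c * (\<Sum>\<^sub>\<infinity>n. b n * x n) + d * (\<Sum>\<^sub>\<infinity>n. b n * y n)"
proof -
  have s: "(\<lambda>n. b n * x n) summable_on UNIV" "(\<lambda>n. b n * y n) summable_on UNIV"
    using Young_power_sum(1)[OF pq assms(1)] assms by (auto intro: abs_summable_summable)
  then have "(\<Sum>\<^sub>\<infinity>n. c * (b n * x n) + d * (b n * y n)) =
      (\<Sum>\<^sub>\<infinity>n. c * (b n * x n)) + (\<Sum>\<^sub>\<infinity>n. d * (b n * y n))"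
    by (intro infsum_add summable_on_cmult_right)
  then show ?thesis by (simp add: algebra_simps infsum_cmult_right')
qed

text \<open>
  The first-order condition for a minimum, with an error term. Suppose that \<open>v\<close> is
  within \<open>\<delta>\<close> of the minimum \<open>I\<close>, and that \<open>y\<close>, a point
  of the segment from \<open>v\<close> to \<open>u\<close>, does not go below \<open>I\<close>. Then
  the image of \<open>y\<close> under the duality map pairs with \<open>u\<close> to at least
  \<open>I\<close>, up to \<open>\<delta> / (p t)\<close>. To see this, expand \<open>power_sum p
  y\<close>, the pairing of that image with \<open>y\<close>, along \<open>y = (1 - t) v + t
  u\<close> and estimate the part with \<open>v\<close> by Young's inequality.
\<close>

lemma near_minimiser_pairing:
  assumes t: "0 < t" "t < 1" and v: "v \<in> lp_space p" and u: "u \<in> lp_space p"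
    and y: "y \<in> lp_space p" "\<And>n. y n = of_real (1 - t) * v n + of_real t * u n"
    and I: "0 \<le> \<delta>" "power_sum p v \<le> I + \<delta>" "I \<le> power_sum p y"
  shows "I - \<delta> / (p * t) \<le> Re (\<Sum>\<^sub>\<infinity>n. duality_map p (y n) * u n)" (is "_ \<le> Re (?S u)")
proof -
  note J = duality_map_lp[OF y(1)]
  have "Re (?S v) \<le> norm (?S v)" by (rule complex_Re_le_cmod)
  also have "\<dots> \<le> (\<Sum>\<^sub>\<infinity>n. norm (duality_map p (y n) * v n))"
    by (rule norm_infsum_bound[OF Young_power_sum(1)[OF pq J(1) v]])
  also have "\<dots> \<le> power_sum p y / q + power_sum p v / p"
    using Young_power_sum(2)[OF pq J(1) v] J(2) by simp
  also have "\<dots> \<le> power_sum p y / q + (I + \<delta>) / p" using I pq by (simp add: divide_right_mono)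
  finally have 1: "Re (?S v) \<le> power_sum p y / q + (I + \<delta>) / p" .
  have "of_real (power_sum p y) = ?S y" using pairing_duality_map_self[OF y(1)] by simp
  also have "\<dots> = of_real (1 - t) * ?S v + of_real t * ?S u"
    unfolding y(2)[of "_::int"] using pairing_linear[OF J(1) v u] y(2) by simp
  finally have "Re (of_real (power_sum p y)) = Re (of_real (1 - t) * ?S v + of_real t * ?S u)" by simp
  then have "power_sum p y = (1 - t) * Re (?S v) + t * Re (?S u)" by simp
  also have "\<dots> \<le> (1 - t) * (power_sum p y / q + (I + \<delta>) / p) + t * Re (?S u)"
    using 1 t by (intro add_right_mono mult_left_mono) auto
  finally have "power_sum p y * (1 - (1 - t) / q) \<le> (1 - t) * (I + \<delta>) / p + t * Re (?S u)"
    by (simp add: algebra_simps)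
  moreover have "I * (1 - (1 - t) / q) \<le> power_sum p y * (1 - (1 - t) / q)"
    using I t pq by (intro mult_right_mono) (auto simp: field_simps)
  ultimately have "I * (1 - (1 - t) / q) - (1 - t) * (I + \<delta>) / p \<le> t * Re (?S u)" by linarith
  moreover have "I * (1 - (1 - t) / q) - (1 - t) * (I + \<delta>) / p = I * t - (1 - t) * \<delta> / p"
  proof -
    have e: "z / q = z - z / p" for z
    proof -
      have "z / q = z * (1 / q)" by simp
      also have "1 / q = 1 - 1 / p" using pq by simp
      finally show ?thesis by (simp add: algebra_simps)
    qed
    show ?thesis unfolding e using pq(1) by (simp add: field_simps)
  qed
  moreover have "(1 - t) * \<delta> / p \<le> \<delta> / p"
    using t pq I by (intro divide_right_mono) (auto simp: mult_left_le_one_le)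
  ultimately have "I * t - \<delta> / p \<le> t * Re (?S u)" by linarith
  then show ?thesis using t pq by (simp add: field_simps)
qed

text \<open>
  With \<open>s\<close> the convex combination, Young's inequality bounds \<open>x * s powr (p -
  1)\<close> and \<open>y * s powr (p - 1)\<close>; averaging the bounds and absorbing the multiple
  of \<open>s powr p\<close> gives convexity.
\<close>

lemma powr_convex_nonneg:
  assumes "0 \<le> t" "t \<le> 1" "0 \<le> x" "0 \<le> y"
  shows "((1 - t) * x + t * y) powr p \<le> (1 - t) * x powr p + t * y powr p"
proof -
  define s where "s = (1 - t) * x + t * y"
  have s: "0 \<le> s" using assms by (simp add: s_def)
  have Y: "z * s powr (p - 1) \<le> z powr p / p + s powr p / q" if "0 \<le> z" for z
    using Youngs_inequality[OF pq that, of "s powr (p - 1)"] by (simp add: powr_powr conjugate_exponent)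
  have "s powr p = s * s powr (p - 1)" using s powr_mult_base[of s "p - 1"] by simp
  also have "\<dots> = (1 - t) * (x * s powr (p - 1)) + t * (y * s powr (p - 1))"
    by (simp add: s_def algebra_simps)
  also have "\<dots> \<le> (1 - t) * (x powr p / p + s powr p / q) + t * (y powr p / p + s powr p / q)"
    using assms Y by (intro add_mono mult_left_mono) auto
  also have "\<dots> = ((1 - t) * x powr p + t * y powr p) / p + s powr p / q"
    by (simp add: add_divide_distrib diff_divide_distrib algebra_simps)
  finally have "s powr p * (1 - 1 / q) \<le> ((1 - t) * x powr p + t * y powr p) / p"
    by (simp add: algebra_simps)
  moreover have "1 - 1 / q = 1 / p" using pq by simp
  ultimately have "s powr p / p \<le> ((1 - t) * x powr p + t * y powr p) / p" by simp
  then have "s powr p \<le> (1 - t) * x powr p + t * y powr p" using pq(1) by (simp add: divide_le_cancel)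
  then show ?thesis by (simp only: s_def)
qed

lemma lp_space_convex_combination:
  assumes "0 \<le> t" "t \<le> 1" "v \<in> lp_space p" "u \<in> lp_space p"
  shows "(\<lambda>n. of_real (1 - t) * v n + of_real t * u n) \<in> lp_space p" (is "?y \<in> _")
    and "power_sum p (\<lambda>n. of_real (1 - t) * v n + of_real t * u n) \<le> (1 - t) * power_sum p v + t * power_sum p u"
proof -
  have conv: "norm (?y n) powr p \<le> (1 - t) * norm (v n) powr p + t * norm (u n) powr p" for n
  proof -
    have "norm (?y n) \<le> (1 - t) * norm (v n) + t * norm (u n)"
      using assms(1,2) norm_triangle_ineq[of "of_real (1 - t) * v n" "of_real t * u n"]
      by (simp add: norm_mult del: of_real_diff)
    then have "norm (?y n) powr p \<le> ((1 - t) * norm (v n) + t * norm (u n)) powr p"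
      using pq(1) by (intro powr_mono2) auto
    also have "\<dots> \<le> (1 - t) * norm (v n) powr p + t * norm (u n) powr p"
      using assms by (intro powr_convex_nonneg) auto
    finally show ?thesis .
  qed
  have *: "(\<Sum>n\<in>F. norm (?y n) powr p) \<le> (1 - t) * power_sum p v + t * power_sum p u" if "finite F" for F
  proof -
    have "(\<Sum>n\<in>F. norm (?y n) powr p) \<le> (1 - t) * (\<Sum>n\<in>F. norm (v n) powr p) + t * (\<Sum>n\<in>F. norm (u n) powr p)"
      unfolding sum_distrib_left sum.distrib[symmetric] by (rule sum_mono) (rule conv)
    also have "\<dots> \<le> (1 - t) * power_sum p v + t * power_sum p u"
      using assms that by (intro add_mono mult_left_mono finite_sum_le_power_sum) auto
    finally show ?thesis .
  qed
  show "?y \<in> lp_space p" "power_sum p ?y \<le> (1 - t) * power_sum p v + t * power_sum p u"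
    by (rule lp_space_from_finite_sums, erule *)+
qed

text \<open>
  The Hahn-Banach separation of a convex set from a ball in \<open>\<ell>\<^sup>p\<close>, with an
  explicit functional. For a minimising sequence in \<open>V\<close> that converges pointwise to
  \<open>a\<close>, the functional is given by the image of \<open>a\<close> under the duality map,
  normalised. Its lower bound at \<open>u \<in> V\<close> is a limit of approximate ones: the
  near-minimisers are moved towards \<open>u\<close> by steps \<open>t\<close> that shrink more
  slowly than their defect, the approximate first-order condition holds at the moved points, and it
  passes to the weak limit of the images of these points.
\<close>

theorem lp_separation:
  fixes V :: "(int \<Rightarrow> complex) set" and d :: real
  assumes "V \<noteq> {}" and V: "V \<subseteq> lp_space p"
    and convex: "\<And>v u t. v \<in> V \<Longrightarrow> u \<in> V \<Longrightarrow> 0 < t \<Longrightarrow> t < 1 \<Longrightarrow> (\<lambda>n. of_real (1 - t) * v n + of_real t * u n) \<in> V"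
    and d: "0 \<le> d" "\<And>v. v \<in> V \<Longrightarrow> d powr p \<le> power_sum p v"
  shows "\<exists>b \<in> lp_space q. power_sum q b \<le> 1 \<and> (\<forall>v\<in>V. d \<le> Re (\<Sum>\<^sub>\<infinity>n. b n * v n))"
proof -
  define I where "I = Inf (power_sum p ` V)"
  have bdd: "bdd_below (power_sum p ` V)" by (auto intro!: bdd_belowI power_sum_nonneg)
  have I_le: "I \<le> power_sum p v" if "v \<in> V" for v
    unfolding I_def using that bdd by (intro cInf_lower) auto
  have I: "d powr p \<le> I" "0 \<le> I"
    using assms(1) d(2) unfolding I_def by (auto intro!: cInf_greatest power_sum_nonneg)
  show ?thesis
  proof (cases "d = 0")
    case True
    have "(\<lambda>_. 0) \<in> lp_space q" "power_sum q (\<lambda>_. 0) \<le> 1" by (simp_all add: lp_space_def power_sum_def)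
    then show ?thesis using True by (intro bexI[of _ "\<lambda>_. 0"]) auto
  next
    case False
    then have "0 < d powr p" by simp
    with I have Ipos: "0 < I" by linarith
    (* The defect is the square of the step length, so that the error term delta / (p t) tends to 0. *)
    define \<delta> where "\<delta> j = inverse (real (j + 2)) ^ 2" for j :: nat
    define t where "t j = inverse (real (j + 2))" for j :: nat
    have \<delta>: "0 < \<delta> j" for j by (simp add: \<delta>_def)
    have t: "0 < t j" "t j < 1" for j by (simp_all add: t_def inverse_less_1_iff)
    have t_lim: "t \<longlonglongrightarrow> 0"
      unfolding t_def using LIMSEQ_ignore_initial_segment[OF LIMSEQ_inverse_real_of_nat, of 1] by (simp add: numeral_2_eq_2)
    have "\<exists>v\<in>V. power_sum p v < I + \<delta> j" for j
      using cInf_lessD[of "power_sum p ` V" "I + \<delta> j"] assms(1) \<delta>[of j] unfolding I_def by auto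
    then obtain v where v: "\<And>j. v j \<in> V" "\<And>j. power_sum p (v j) < I + \<delta> j" by metis
    have \<delta>1: "\<delta> j \<le> 1" for j unfolding \<delta>_def by (intro power_le_one) (auto simp: field_simps)
    have vlp: "v j \<in> lp_space p" for j using v(1) V by auto
    have vb: "norm (v j n) \<le> (I + 1) powr (1 / p)" for j n
    proof -
      have "norm (v j n) powr p \<le> I + 1"
        using coordinate_le_power_sum[OF vlp, of j n] v(2)[of j] \<delta>1[of j] by linarith
      then have "(norm (v j n) powr p) powr (1 / p) \<le> (I + 1) powr (1 / p)"
        using pq by (intro powr_mono2) auto
      then show ?thesis using pq by (simp add: powr_powr)
    qed
    obtain r a where r: "strict_mono r" and a: "\<And>n. (\<lambda>j. v (r j) n) \<longlonglongrightarrow> a n"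
      by (rule bounded_pointwise_convergent_subsequence[of v, OF vb]) (rule that)
    have tr: "(\<lambda>j. t (r j)) \<longlonglongrightarrow> 0" using LIMSEQ_subseq_LIMSEQ[OF t_lim r] by (simp add: o_def)
    have alp: "a \<in> lp_space p" "power_sum p a \<le> I"
    proof -
      have "(\<lambda>j. I + t (r j)) \<longlonglongrightarrow> I + 0" by (intro tendsto_intros tr)
      moreover have "power_sum p (v (r j)) \<le> I + t (r j)" for j
      proof -
        have "\<delta> i \<le> t i" for i
          using t[of i] mult_left_le[of "t i" "t i"] by (simp add: \<delta>_def t_def power2_eq_square)
        then show ?thesis using v(2)[of "r j"] by (meson add_left_mono less_imp_le order_trans)
      qed
      ultimately show "a \<in> lp_space p" "power_sum p a \<le> I"
        using power_sum_fatou[where s=p and x="\<lambda>j. v (r j)" and C="\<lambda>j. I + t (r j)" and c=I and y=a] vlp a pq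
        by auto
    qed
    define J where "J n = duality_map p (a n)" for n
    have Jlp: "J \<in> lp_space q" "power_sum q J \<le> I"
      using duality_map_lp[OF alp(1)] alp(2) by (simp_all add: J_def[abs_def])
    have key: "I \<le> Re (\<Sum>\<^sub>\<infinity>n. J n * u n)" if u: "u \<in> V" for u
    proof -
      have ulp: "u \<in> lp_space p" using u V by auto
      define y where "y j n = of_real (1 - t (r j)) * v (r j) n + of_real (t (r j)) * u n" for j n
      have y: "y j \<in> V" for j unfolding y_def[abs_def] using v(1) u t by (intro convex) auto
      then have ylp: "y j \<in> lp_space p" for j using V by auto
      have "power_sum p (y j) \<le> I + 1 + power_sum p u" for j
      proof -
        have "power_sum p (y j) \<le> (1 - t (r j)) * power_sum p (v (r j)) + t (r j) * power_sum p u"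
          unfolding y_def[abs_def] using t[of "r j"] vlp ulp by (intro lp_space_convex_combination) auto
        also have "\<dots> \<le> power_sum p (v (r j)) + power_sum p u"
          using t[of "r j"] by (intro add_mono mult_left_le_one_le power_sum_nonneg) auto
        also have "\<dots> \<le> I + 1 + power_sum p u" using v(2)[of "r j"] \<delta>1[of "r j"] by linarith
        finally show ?thesis .
      qed
      moreover have "(\<lambda>j. duality_map p (y j n)) \<longlonglongrightarrow> J n" for n
      proof -
        have "(\<lambda>j. y j n) \<longlonglongrightarrow> of_real (1 - 0) * a n + of_real 0 * u n"
          unfolding y_def by (intro tendsto_intros a tr)
        then show ?thesis unfolding J_def using pq by (intro tendsto_duality_map) auto
      qed
      ultimately have "(\<lambda>j. \<Sum>\<^sub>\<infinity>n. duality_map p (y j n) * u n) \<longlonglongrightarrow> (\<Sum>\<^sub>\<infinity>n. J n * u n)"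
        using duality_map_lp[OF ylp] by (intro lp_pairing_tendsto[OF pq ulp]) auto
      then have "(\<lambda>j. Re (\<Sum>\<^sub>\<infinity>n. duality_map p (y j n) * u n)) \<longlonglongrightarrow> Re (\<Sum>\<^sub>\<infinity>n. J n * u n)"
        by (rule tendsto_Re)
      moreover have "(\<lambda>j. I - t (r j) / p) \<longlonglongrightarrow> I - 0 / p" using pq by (intro tendsto_intros tr) auto
      moreover have "I - t (r j) / p \<le> Re (\<Sum>\<^sub>\<infinity>n. duality_map p (y j n) * u n)" for j
      proof -
        have "I - \<delta> (r j) / (p * t (r j)) \<le> Re (\<Sum>\<^sub>\<infinity>n. duality_map p (y j n) * u n)"
          using t[of "r j"] vlp ulp ylp[of j] \<delta>[of "r j"] v(2)[of "r j"] I_le[OF y[of j]]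
          by (intro near_minimiser_pairing[where v="v (r j)" and y="y j"]) (auto simp del: of_real_diff simp: y_def[of j])
        moreover have "\<delta> i = t i * t i" for i by (simp only: \<delta>_def t_def power2_eq_square)
        then have "\<delta> i / (p * t i) = t i / p" for i using t[of i] by simp
        ultimately show ?thesis by simp
      qed
      ultimately show ?thesis by (intro LIMSEQ_le[of "\<lambda>j. I - t (r j) / p" I]) auto
    qed
    (* The q-th power sum of J equals the p-th power sum of a, which is at most I by Fatou. *)
    let ?s = "of_real (I powr (- 1 / q)) :: complex"
    have "norm ?s powr q = I powr (- 1)" using pq(2) by (simp add: powr_powr del: powr_minus)
    then have "power_sum q (\<lambda>n. ?s * J n) \<le> I powr (- 1) * I"
      unfolding lp_space_scale(2)[OF Jlp(1)] using Jlp(2) Ipos by (simp add: divide_right_mono)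
    then have 1: "power_sum q (\<lambda>n. ?s * J n) \<le> 1" using Ipos by (simp add: powr_minus)
    have "d \<le> Re (\<Sum>\<^sub>\<infinity>n. ?s * J n * u n)" if "u \<in> V" for u
    proof -
      have "d = (d powr p) powr (1 / p)" using d pq by (simp add: powr_powr)
      also have "\<dots> \<le> I powr (1 / p)" using I pq by (intro powr_mono2) auto
      also have "1 / p = - 1 / q + 1" using pq by simp
      also have "I powr \<dots> = I powr (- 1 / q) * I" using Ipos powr_add[of I "- 1 / q" 1] by simp
      also have "\<dots> \<le> I powr (- 1 / q) * Re (\<Sum>\<^sub>\<infinity>n. J n * u n)"
        using key[OF that] by (intro mult_left_mono) auto
      also have "\<dots> = Re (\<Sum>\<^sub>\<infinity>n. ?s * J n * u n)"
        by (simp add: mult.assoc infsum_cmult_right')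
      finally show ?thesis .
    qed
    then show ?thesis using 1 lp_space_scale(1)[OF Jlp(1), of ?s] by (intro bexI[of _ "\<lambda>n. ?s * J n"]) auto
  qed
qed
end

section \<open>Real charges and the Jordan decomposition\<close>

locale real_charge =
  fixes M :: "'a measure" and \<nu> :: "'a set \<Rightarrow> real"
  assumes sums: "\<And>A :: nat \<Rightarrow> 'a set. range A \<subseteq> sets M \<Longrightarrow> disjoint_family A \<Longrightarrow> (\<lambda>i. \<nu> (A i)) sums \<nu> (\<Union>i. A i)"
    and bounded: "\<exists>K. \<forall>A\<in>sets M. \<bar>\<nu> A\<bar> \<le> K"
begin

lemma vanishes_empty: "\<nu> {} = 0"
proof -
  have "(\<lambda>i::nat. \<nu> {}) sums \<nu> {}"
    using sums[of "\<lambda>_. {}"] by (simp add: disjoint_family_on_def)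
  then have "(\<lambda>i::nat. \<nu> {}) \<longlonglongrightarrow> 0" by (intro summable_LIMSEQ_zero) (auto simp: summable_def)
  then show ?thesis by (simp add: LIMSEQ_const_iff)
qed

lemma Un:
  assumes "A \<in> sets M" "B \<in> sets M" "A \<inter> B = {}"
  shows "\<nu> (A \<union> B) = \<nu> A + \<nu> B"
proof -
  let ?F = "\<lambda>i::nat. if i = 0 then A else if i = 1 then B else {}"
  have U: "(\<Union>i. ?F i) = A \<union> B" by (auto split: if_splits)
  have "(\<lambda>i. \<nu> (?F i)) sums \<nu> (\<Union>i. ?F i)"
    using assms by (intro sums) (auto simp: disjoint_family_on_def)
  moreover have "(\<lambda>i. \<nu> (?F i)) sums (\<Sum>i\<in>{0,1}. \<nu> (?F i))"
    by (intro sums_finite) (auto simp: vanishes_empty)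
  ultimately show ?thesis unfolding U by (auto dest: sums_unique2)
qed

lemma Diff:
  assumes "A \<in> sets M" "B \<in> sets M" "B \<subseteq> A"
  shows "\<nu> (A - B) = \<nu> A - \<nu> B"
  using Un[of "A - B" B] assms by (auto simp: Un_absorb2 Diff_disjoint Int_commute)

text \<open>
  The positive variation. The charge is bounded, so the supremum can be taken in the reals.
\<close>

definition upper :: "'a set \<Rightarrow> real" where
  "upper A = (SUP B \<in> {B \<in> sets M. B \<subseteq> A}. \<nu> B)"

lemma bdd: "bdd_above (\<nu> ` {B \<in> sets M. B \<subseteq> A})"
proof -
  obtain K where "\<forall>A\<in>sets M. \<bar>\<nu> A\<bar> \<le> K" using bounded by blast
  then show ?thesis by (intro bdd_aboveI2[of _ _ K]) auto
qed

lemma le_upper: "B \<in> sets M \<Longrightarrow> B \<subseteq> A \<Longrightarrow> \<nu> B \<le> upper A"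
  unfolding upper_def using bdd by (intro cSUP_upper) auto

lemma upper_le: "(\<And>B. B \<in> sets M \<Longrightarrow> B \<subseteq> A \<Longrightarrow> \<nu> B \<le> c) \<Longrightarrow> upper A \<le> c"
  unfolding upper_def by (intro cSUP_least) auto

lemma upper_nonneg: "0 \<le> upper A"
  using le_upper[of "{}" A] vanishes_empty by simp

lemma upper_Un:
  assumes "A \<in> sets M" "B \<in> sets M" "A \<inter> B = {}"
  shows "upper A + upper B \<le> upper (A \<union> B)"
proof -
  have "upper A \<le> upper (A \<union> B) - upper B"
  proof (rule upper_le)
    fix C assume C: "C \<in> sets M" "C \<subseteq> A"
    have "upper B \<le> upper (A \<union> B) - \<nu> C"
    proof (rule upper_le)
      fix D assume D: "D \<in> sets M" "D \<subseteq> B"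
      have "\<nu> C + \<nu> D = \<nu> (C \<union> D)" using C D assms by (intro Un[symmetric]) auto
      also have "\<dots> \<le> upper (A \<union> B)" using C D by (intro le_upper) auto
      finally show "\<nu> D \<le> upper (A \<union> B) - \<nu> C" by simp
    qed
    then show "\<nu> C \<le> upper (A \<union> B) - upper B" by simp
  qed
  then show ?thesis by simp
qed

lemma upper_mono: "A \<subseteq> B \<Longrightarrow> upper A \<le> upper B"
  by (intro upper_le le_upper) auto

text \<open>
  Superadditivity on disjoint sets and monotonicity bound the partial sums from above. Conversely,
  any competitor \<open>B\<close> is cut into its pieces \<open>B \<inter> A i\<close>, which
  compete in the separate suprema.
\<close>

lemma upper_sums:
  assumes A: "range A \<subseteq> sets M" "disjoint_family (A :: nat \<Rightarrow> 'a set)"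
  shows "(\<lambda>i. upper (A i)) sums upper (\<Union>i. A i)"
proof -
  have partial: "(\<Sum>i<n. upper (A i)) \<le> upper (\<Union>i<n. A i)" for n
  proof (induction n)
    case (Suc n)
    have "(\<Sum>i<Suc n. upper (A i)) \<le> upper (\<Union>i<n. A i) + upper (A n)" using Suc by simp
    also have "\<dots> \<le> upper ((\<Union>i<n. A i) \<union> A n)"
    proof (rule upper_Un)
      show "(\<Union>i<n. A i) \<in> sets M" "A n \<in> sets M" using A by auto
      have "A i \<inter> A n = {}" if "i < n" for i
        using disjoint_family_onD[OF A(2), of i n] that by simp
      then show "(\<Union>i<n. A i) \<inter> A n = {}" by blast
    qed
    finally show ?case by (simp add: lessThan_Suc Un_commute)
  qed (simp add: upper_nonneg)
  have le: "(\<Sum>i<n. upper (A i)) \<le> upper (\<Union>i. A i)" for n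
    by (rule order_trans[OF partial]) (auto intro: upper_mono)
  have s: "summable (\<lambda>i. upper (A i))"
    by (rule summableI_nonneg_bounded[OF upper_nonneg le])
  have "upper (\<Union>i. A i) \<le> (\<Sum>i. upper (A i))"
  proof (rule upper_le)
    fix B assume B: "B \<in> sets M" "B \<subseteq> (\<Union>i. A i)"
    have "(\<lambda>i. \<nu> (B \<inter> A i)) sums \<nu> (\<Union>i. B \<inter> A i)"
      using A B by (intro sums) (auto simp: disjoint_family_on_def)
    also have "(\<Union>i. B \<inter> A i) = B" using B by auto
    finally have b: "(\<lambda>i. \<nu> (B \<inter> A i)) sums \<nu> B" .
    show "\<nu> B \<le> (\<Sum>i. upper (A i))"
      using A B by (intro sums_le[OF _ b summable_sums[OF s]] le_upper) auto
  qed
  moreover have "(\<Sum>i. upper (A i)) \<le> upper (\<Union>i. A i)"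
    using le s by (intro suminf_le_const) auto
  ultimately show ?thesis using s by (simp add: sums_iff)
qed

text \<open>
  Truncating negative values to zero does not change the supremum, since the empty set contributes
  zero anyway.
\<close>

lemma SUP_ennreal_upper: "(SUP B \<in> {B \<in> sets M. B \<subseteq> A}. ennreal (\<nu> B)) = ennreal (upper A)"
proof (rule antisym)
  show "(SUP B \<in> {B \<in> sets M. B \<subseteq> A}. ennreal (\<nu> B)) \<le> ennreal (upper A)"
    by (intro SUP_least ennreal_leI) (auto intro: le_upper)
  let ?S = "SUP B \<in> {B \<in> sets M. B \<subseteq> A}. ennreal (\<nu> B)"
  have fin: "?S < top"
    by (rule order_le_less_trans[of _ "ennreal (upper A)"])
       (auto intro!: SUP_least ennreal_leI le_upper simp: ennreal_less_top)
  have "upper A \<le> enn2real ?S"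
  proof (rule upper_le)
    fix B assume B: "B \<in> sets M" "B \<subseteq> A"
    have "ennreal (\<nu> B) \<le> ?S" using B by (intro SUP_upper) auto
    then have "enn2real (ennreal (\<nu> B)) \<le> enn2real ?S" using fin by (intro enn2real_mono)
    then show "\<nu> B \<le> enn2real ?S" by (cases "0 \<le> \<nu> B") (auto intro: order_trans[OF _ enn2real_nonneg])
  qed
  then have "ennreal (upper A) \<le> ennreal (enn2real ?S)" by (rule ennreal_leI)
  then show "ennreal (upper A) \<le> ?S" using fin by simp
qed

lemma space_positive_part [simp]: "space (positive_part M \<nu>) = space M"
  and sets_positive_part [measurable_cong, simp]: "sets (positive_part M \<nu>) = sets M"
  unfolding positive_part_def by (auto simp: sets.space_closed space_measure_of_conv sets.sigma_sets_eq)

lemma emeasure_positive_part: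
  assumes "A \<in> sets M"
  shows "emeasure (positive_part M \<nu>) A = ennreal (upper A)"
proof (subst emeasure_measure_of[OF positive_part_def])
  show "countably_additive (sets (positive_part M \<nu>)) (\<lambda>A. SUP B \<in> {B \<in> sets M. B \<subseteq> A}. ennreal (\<nu> B))"
    unfolding countably_additive_def sets_positive_part SUP_ennreal_upper
  proof (intro allI impI)
    fix F :: "nat \<Rightarrow> 'a set" assume F: "range F \<subseteq> sets M" "disjoint_family F"
    show "(\<Sum>i. ennreal (upper (F i))) = ennreal (upper (\<Union>i. F i))"
      using upper_sums[OF F] upper_nonneg by (intro suminf_ennreal_eq)
  qed
  show "positive (sets (positive_part M \<nu>)) (\<lambda>A. SUP B \<in> {B \<in> sets M. B \<subseteq> A}. ennreal (\<nu> B))"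
    unfolding positive_def SUP_ennreal_upper using upper_le[of "{}" 0] upper_nonneg[of "{}"] vanishes_empty by (auto simp: order_antisym)
qed (use assms in \<open>auto simp: SUP_ennreal_upper sets.space_closed\<close>)

lemma measure_positive_part: "A \<in> sets M \<Longrightarrow> measure (positive_part M \<nu>) A = upper A"
  by (simp add: measure_def emeasure_positive_part upper_nonneg)

lemma finite_measure_positive_part: "finite_measure (positive_part M \<nu>)"
  by (rule finite_measureI) (simp add: emeasure_positive_part)

end

lemma real_charge_uminus: "real_charge M \<nu> \<Longrightarrow> real_charge M (\<lambda>A. - \<nu> A)"
  unfolding real_charge_def by (auto intro: sums_minus)

text \<open>
  For \<open>B \<subseteq> A\<close> the identity \<open>\<nu> B = \<nu> A - \<nu> (A - B)\<close>
  turns competitors for the positive variation into competitors for the negative one and back, so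
  the two suprema differ by \<open>\<nu> A\<close>.
\<close>

lemma Jordan_decomposition:
  assumes "real_charge M \<nu>" "A \<in> sets M"
  shows "measure (positive_part M \<nu>) A - measure (positive_part M (\<lambda>A. - \<nu> A)) A = \<nu> A"
proof -
  interpret P: real_charge M \<nu> by fact
  interpret N: real_charge M "\<lambda>A. - \<nu> A" by (rule real_charge_uminus) fact
  have "P.upper A \<le> \<nu> A + N.upper A"
  proof (rule P.upper_le)
    fix B assume B: "B \<in> sets M" "B \<subseteq> A"
    have "- \<nu> (A - B) \<le> N.upper A" using assms B by (intro N.le_upper) auto
    then show "\<nu> B \<le> \<nu> A + N.upper A" using P.Diff[OF assms(2) B] by simp
  qed
  moreover have "N.upper A \<le> P.upper A - \<nu> A"
  proof (rule N.upper_le)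
    fix B assume B: "B \<in> sets M" "B \<subseteq> A"
    have "\<nu> (A - B) \<le> P.upper A" using assms B by (intro P.le_upper) auto
    then show "- \<nu> B \<le> P.upper A - \<nu> A" using P.Diff[OF assms(2) B] by simp
  qed
  ultimately show ?thesis
    using assms(2) by (simp add: P.measure_positive_part N.measure_positive_part)
qed

section \<open>Linear functionals bounded in the supremum norm\<close>

definition bounded_measurable :: "'a measure \<Rightarrow> ('a \<Rightarrow> complex) set" where
  "bounded_measurable M = {f \<in> borel_measurable M. \<exists>B. \<forall>x\<in>space M. norm (f x) \<le> B}"

lemma bounded_measurableI:
  "f \<in> borel_measurable M \<Longrightarrow> (\<And>x. x \<in> space M \<Longrightarrow> norm (f x) \<le> B) \<Longrightarrow> f \<in> bounded_measurable M"
  by (auto simp: bounded_measurable_def)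

lemma bounded_measurableE:
  assumes "f \<in> bounded_measurable M"
  obtains B where "0 \<le> B" "\<And>x. x \<in> space M \<Longrightarrow> norm (f x) \<le> B"
proof -
  obtain B where "\<forall>x\<in>space M. norm (f x) \<le> B" using assms by (auto simp: bounded_measurable_def)
  then show thesis by (intro that[of "max 0 B"]) auto
qed

lemma bounded_measurable_measurable: "f \<in> bounded_measurable M \<Longrightarrow> f \<in> borel_measurable M"
  by (simp add: bounded_measurable_def)

lemma bounded_measurable_add:
  assumes "f \<in> bounded_measurable M" "g \<in> bounded_measurable M"
  shows "(\<lambda>x. f x + g x) \<in> bounded_measurable M"
proof -
  obtain B C where "\<And>x. x \<in> space M \<Longrightarrow> norm (f x) \<le> B" "\<And>x. x \<in> space M \<Longrightarrow> norm (g x) \<le> C"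
    using assms by (auto elim!: bounded_measurableE)
  moreover have [measurable]: "f \<in> borel_measurable M" "g \<in> borel_measurable M"
    using assms by (auto intro: bounded_measurable_measurable)
  ultimately show ?thesis
    by (intro bounded_measurableI[of _ _ "B + C"]) (auto intro!: norm_triangle_le add_mono)
qed

lemma bounded_measurable_mult:
  assumes "f \<in> bounded_measurable M" "g \<in> bounded_measurable M"
  shows "(\<lambda>x. f x * g x) \<in> bounded_measurable M"
proof -
  obtain B C where "0 \<le> B" "\<And>x. x \<in> space M \<Longrightarrow> norm (f x) \<le> B" "\<And>x. x \<in> space M \<Longrightarrow> norm (g x) \<le> C"
    using assms by (auto elim!: bounded_measurableE)
  moreover have [measurable]: "f \<in> borel_measurable M" "g \<in> borel_measurable M"
    using assms by (auto intro: bounded_measurable_measurable)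
  ultimately show ?thesis
    by (intro bounded_measurableI[of _ _ "B * C"]) (auto simp: norm_mult intro!: mult_mono)
qed

lemma bounded_measurable_const [simp]: "(\<lambda>x. c) \<in> bounded_measurable M"
  by (rule bounded_measurableI[of _ _ "norm c"]) auto

lemma bounded_measurable_indicator [simp]: "A \<in> sets M \<Longrightarrow> indicator A \<in> bounded_measurable M"
  by (rule bounded_measurableI[of _ _ 1]) (auto simp: indicator_def)

lemma bounded_measurable_cmult: "f \<in> bounded_measurable M \<Longrightarrow> (\<lambda>x. c * f x) \<in> bounded_measurable M"
  by (intro bounded_measurable_mult) auto

lemma bounded_measurable_diff:
  "f \<in> bounded_measurable M \<Longrightarrow> g \<in> bounded_measurable M \<Longrightarrow> (\<lambda>x. f x - g x) \<in> bounded_measurable M"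
  using bounded_measurable_add[OF _ bounded_measurable_cmult[of g M "-1"], of f] by simp

lemma bounded_measurable_sum:
  "(\<And>i. i \<in> I \<Longrightarrow> f i \<in> bounded_measurable M) \<Longrightarrow> (\<lambda>x. \<Sum>i\<in>I. f i x) \<in> bounded_measurable M"
  by (induction I rule: infinite_finite_induct) (auto intro: bounded_measurable_add)

lemma (in finite_measure) integrable_bounded_measurable:
  "f \<in> bounded_measurable M \<Longrightarrow> integrable M f"
  by (rule bounded_measurableE, assumption) (auto intro!: integrable_const_bound AE_I2 bounded_measurable_measurable)

text \<open>
  The integral against a complex measure and the pairing with a fixed square-summable sequence of
  Fourier coefficients are both functionals of this kind. They are compared by checking them on a
  uniformly dense set of functions.
\<close>

locale sup_continuous_functional =
  fixes M :: "'a measure" and T :: "('a \<Rightarrow> complex) \<Rightarrow> complex" and K :: real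
  assumes add: "f \<in> bounded_measurable M \<Longrightarrow> g \<in> bounded_measurable M \<Longrightarrow> T (\<lambda>x. f x + g x) = T f + T g"
    and cmult: "f \<in> bounded_measurable M \<Longrightarrow> T (\<lambda>x. c * f x) = c * T f"
    and bound: "f \<in> bounded_measurable M \<Longrightarrow> 0 \<le> B \<Longrightarrow> (\<And>x. x \<in> space M \<Longrightarrow> norm (f x) \<le> B) \<Longrightarrow> norm (T f) \<le> K * B"
begin

lemma diff: "f \<in> bounded_measurable M \<Longrightarrow> g \<in> bounded_measurable M \<Longrightarrow> T (\<lambda>x. f x - g x) = T f - T g"
  using add[of f "\<lambda>x. -1 * g x"] cmult[of g "-1"] bounded_measurable_cmult[of g M "-1"] by simp

lemma zero: "T (\<lambda>x. 0) = 0"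
  using cmult[of "\<lambda>_. 0" 0] by simp

lemma cong:
  assumes "f \<in> bounded_measurable M" "g \<in> bounded_measurable M" "\<And>x. x \<in> space M \<Longrightarrow> f x = g x"
  shows "T f = T g"
proof -
  have "norm (T (\<lambda>x. f x - g x)) \<le> K * 0"
    by (rule bound) (use assms in \<open>auto intro: bounded_measurable_diff\<close>)
  then show ?thesis using assms(1,2) by (simp add: diff)
qed

lemma sum: "finite I \<Longrightarrow> (\<And>i. i \<in> I \<Longrightarrow> f i \<in> bounded_measurable M) \<Longrightarrow> T (\<lambda>x. \<Sum>i\<in>I. f i x) = (\<Sum>i\<in>I. T (f i))"
  by (induction I rule: finite_induct) (auto simp: zero add bounded_measurable_sum)

lemma bound_nonneg: "0 \<le> K"
  using bound[of "\<lambda>_. 0" 1] norm_ge_zero[of "T (\<lambda>_. 0)"] by (simp add: zero)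

end

lemma sup_continuous_functional_eqI:
  assumes "sup_continuous_functional M S K" "sup_continuous_functional M T L"
    and f: "f \<in> bounded_measurable M"
    and approx: "\<And>e. 0 < e \<Longrightarrow> \<exists>g\<in>bounded_measurable M. S g = T g \<and> (\<forall>x\<in>space M. norm (f x - g x) \<le> e)"
  shows "S f = T f"
proof -
  interpret S: sup_continuous_functional M S K by fact
  interpret T: sup_continuous_functional M T L by fact
  have "norm (S f - T f) \<le> 0 + e" if "0 < e" for e
  proof -
    define d where "d = e / (K + L + 1)"
    have d: "0 < d" using that S.bound_nonneg T.bound_nonneg by (simp add: d_def)
    obtain g where g: "g \<in> bounded_measurable M" "S g = T g" "\<And>x. x \<in> space M \<Longrightarrow> norm (f x - g x) \<le> d"
      using approx[OF d] by auto
    have "norm (S (\<lambda>x. f x - g x)) \<le> K * d" "norm (T (\<lambda>x. f x - g x)) \<le> L * d"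
      using f g d by (auto intro!: S.bound T.bound bounded_measurable_diff)
    moreover have "S f - T f = S (\<lambda>x. f x - g x) - T (\<lambda>x. f x - g x)"
      using f g by (simp add: S.diff T.diff)
    ultimately have "norm (S f - T f) \<le> K * d + L * d"
      using norm_triangle_ineq4[of "S (\<lambda>x. f x - g x)" "T (\<lambda>x. f x - g x)"] by simp
    also have "\<dots> \<le> e"
    proof -
      have "K * d + L * d = (K + L) / (K + L + 1) * e" by (simp add: d_def add_divide_distrib distrib_right)
      also have "\<dots> \<le> 1 * e" using that S.bound_nonneg T.bound_nonneg by (intro mult_right_mono) auto
      finally show ?thesis by simp
    qed
    finally show ?thesis by simp
  qed
  then have "norm (S f - T f) \<le> 0" by (rule field_le_epsilon)
  then show ?thesis by simp
qed

text \<open>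
  Round the real and the imaginary part down to multiples of \<open>e / 2\<close>.
\<close>

lemma uniform_simple_approximation:
  assumes f: "f \<in> bounded_measurable M" and "0 < e"
  shows "\<exists>V. finite V \<and> (\<exists>A. (\<forall>v\<in>V. A v \<in> sets M) \<and> 
     (\<forall>x\<in>space M. norm (f x - (\<Sum>v\<in>V. v * indicator (A v) x)) \<le> e))"
proof -
  obtain B where B: "0 \<le> B" "\<And>x. x \<in> space M \<Longrightarrow> norm (f x) \<le> B"
    using bounded_measurableE[OF f] by blast
  have [measurable]: "f \<in> borel_measurable M" using f by (rule bounded_measurable_measurable)
  define r where "r t = e / 2 * of_int \<lfloor>t / (e / 2)\<rfloor>" for t :: real
  define s where "s x = Complex (r (Re (f x))) (r (Im (f x)))" for x
  have r: "\<bar>t - r t\<bar> \<le> e / 2" for t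
  proof -
    have "t - r t = e / 2 * (t / (e / 2) - of_int \<lfloor>t / (e / 2)\<rfloor>)" using assms(2) by (simp add: r_def algebra_simps)
    also have "\<bar>\<dots>\<bar> = e / 2 * frac (t / (e / 2))" using assms(2) by (simp add: frac_def[symmetric] abs_mult)
    also have "\<dots> \<le> e / 2 * 1" using assms(2) by (intro mult_left_mono) (auto intro: less_imp_le frac_lt_1)
    finally show ?thesis by simp
  qed
  let ?R = "(\<lambda>k. e / 2 * of_int k) ` {\<lfloor>- B / (e / 2)\<rfloor>..\<lfloor>B / (e / 2)\<rfloor>}"
  let ?V = "(\<lambda>(a, b). Complex a b) ` (?R \<times> ?R)"
  have "r t \<in> ?R" if "\<bar>t\<bar> \<le> B" for t
  proof -
    have "- B / (e / 2) \<le> t / (e / 2)" "t / (e / 2) \<le> B / (e / 2)"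
      using that assms(2) by (intro divide_right_mono; simp)+
    then show ?thesis unfolding r_def by (intro imageI) (auto intro!: floor_mono)
  qed
  then have sV: "s x \<in> ?V" if "x \<in> space M" for x
    using B(2)[OF that] abs_Re_le_cmod[of "f x"] abs_Im_le_cmod[of "f x"]
    unfolding s_def by (intro image_eqI[of _ _ "(r (Re (f x)), r (Im (f x)))"]) auto
  have fin: "finite ?V" by auto
  have [measurable]: "s \<in> borel_measurable M"
    unfolding s_def r_def complex_eq_iff Complex_eq by measurable
  let ?A = "\<lambda>v. {x \<in> space M. s x = v}"
  have "norm (f x - (\<Sum>v\<in>?V. v * indicator (?A v) x)) \<le> e" if x: "x \<in> space M" for x
  proof -
    have "(\<Sum>v\<in>?V. v * indicator (?A v) x) = (\<Sum>v\<in>?V. if v = s x then v else 0)"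
      using x by (intro sum.cong) (auto simp: indicator_def)
    also have "\<dots> = s x" using sV[OF x] fin by (simp add: sum.delta)
    finally have "norm (f x - (\<Sum>v\<in>?V. v * indicator (?A v) x)) = norm (f x - s x)" by simp
    also have "\<dots> \<le> \<bar>Re (f x) - r (Re (f x))\<bar> + \<bar>Im (f x) - r (Im (f x))\<bar>"
      using cmod_le[of "f x - s x"] by (simp add: s_def)
    also have "\<dots> \<le> e" using r[of "Re (f x)"] r[of "Im (f x)"] by linarith
    finally show ?thesis .
  qed
  moreover have "\<forall>v\<in>?V. ?A v \<in> sets M" by auto
  ultimately show ?thesis using fin by (intro exI[of _ ?V] conjI exI[of _ ?A]) auto
qed

lemma sup_continuous_functional_eq_on_indicators:
  assumes S: "sup_continuous_functional M S K" and T: "sup_continuous_functional M T L"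
    and ind: "\<And>A. A \<in> sets M \<Longrightarrow> S (indicator A) = T (indicator A)"
    and f: "f \<in> bounded_measurable M"
  shows "S f = T f"
proof (rule sup_continuous_functional_eqI[OF S T f])
  interpret S: sup_continuous_functional M S K by fact
  interpret T: sup_continuous_functional M T L by fact
  fix e :: real assume "0 < e"
  from uniform_simple_approximation[OF f this] obtain V A where V: "finite V" "\<And>v. v \<in> V \<Longrightarrow> A v \<in> sets M"
    and a: "\<forall>x\<in>space M. norm (f x - (\<Sum>v\<in>V. v * indicator (A v) x)) \<le> e" by blast
  have bm: "(\<lambda>x. v * indicator (A v) x) \<in> bounded_measurable M" if "v \<in> V" for v
    using V that by (intro bounded_measurable_cmult) auto
  have "S (\<lambda>x. \<Sum>v\<in>V. v * indicator (A v) x) = (\<Sum>v\<in>V. v * S (indicator (A v)))"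
    using V bm by (subst S.sum) (auto simp del: sum_mult_indicator intro!: sum.cong S.cmult[symmetric] S.cmult)
  also have "\<dots> = (\<Sum>v\<in>V. v * T (indicator (A v)))" using V ind by simp
  also have "\<dots> = T (\<lambda>x. \<Sum>v\<in>V. v * indicator (A v) x)"
    using V bm by (subst T.sum) (auto simp del: sum_mult_indicator intro!: sum.cong T.cmult[symmetric] T.cmult)
  finally show "\<exists>g\<in>bounded_measurable M. S g = T g \<and> (\<forall>x\<in>space M. norm (f x - g x) \<le> e)"
    using a V bm by (intro bexI[of _ "\<lambda>x. \<Sum>v\<in>V. v * indicator (A v) x"]) (auto simp del: sum_mult_indicator intro: bounded_measurable_sum)
qed

section \<open>Integration against finite complex measures\<close>

locale finite_complex_measure =
  fixes M :: "'a measure" and \<mu> :: "'a set \<Rightarrow> complex"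
  assumes complex_measure: "complex_measure M \<mu>"
    and finite_variation: "total_variation M \<mu> (space M) < \<infinity>"
begin

lemma sums: "range A \<subseteq> sets M \<Longrightarrow> disjoint_family A \<Longrightarrow> (\<lambda>i::nat. \<mu> (A i)) sums \<mu> (\<Union>i. A i)"
  using complex_measure by (auto simp: complex_measure_def)

text \<open>
  Use the partition of \<open>A\<close> into \<open>B\<close>, its complement and empty sets.
\<close>

lemma norm_le_total_variation:
  assumes "A \<in> sets M" "B \<in> sets M" "B \<subseteq> A"
  shows "ennreal (norm (\<mu> B)) \<le> total_variation M \<mu> A"
proof -
  let ?P = "\<lambda>i::nat. if i = 0 then B else if i = 1 then A - B else {}"
  have "ennreal (norm (\<mu> B)) = (\<Sum>i\<in>{0}. ennreal (norm (\<mu> (?P i))))" by simp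
  also have "\<dots> \<le> (\<Sum>i. ennreal (norm (\<mu> (?P i))))" by (intro sum_le_suminf) auto
  also have "\<dots> \<le> total_variation M \<mu> A"
    unfolding total_variation_def using assms
    by (intro SUP_upper) (auto simp: disjoint_family_on_def split: if_splits)
  finally show ?thesis .
qed

lemma bounded: "\<exists>K. \<forall>A\<in>sets M. norm (\<mu> A) \<le> K"
proof (intro exI ballI)
  fix A assume "A \<in> sets M"
  then have "ennreal (norm (\<mu> A)) \<le> total_variation M \<mu> (space M)"
    by (intro norm_le_total_variation) (auto dest: sets.sets_into_space)
  then have "enn2real (ennreal (norm (\<mu> A))) \<le> enn2real (total_variation M \<mu> (space M))"
    using finite_variation by (intro enn2real_mono) auto
  then show "norm (\<mu> A) \<le> enn2real (total_variation M \<mu> (space M))" by simp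
qed

sublocale Re: real_charge M "\<lambda>A. Re (\<mu> A)"
proof
  show "(\<lambda>i::nat. Re (\<mu> (A i))) sums Re (\<mu> (\<Union>i. A i))" if "range A \<subseteq> sets M" "disjoint_family A" for A
    using sums_Re[OF sums[OF that]] .
  show "\<exists>K. \<forall>A\<in>sets M. \<bar>Re (\<mu> A)\<bar> \<le> K"
    using bounded abs_Re_le_cmod order_trans by meson
qed

sublocale Im: real_charge M "\<lambda>A. Im (\<mu> A)"
proof
  show "(\<lambda>i::nat. Im (\<mu> (A i))) sums Im (\<mu> (\<Union>i. A i))" if "range A \<subseteq> sets M" "disjoint_family A" for A
    using sums_Im[OF sums[OF that]] .
  show "\<exists>K. \<forall>A\<in>sets M. \<bar>Im (\<mu> A)\<bar> \<le> K"
    using bounded abs_Im_le_cmod order_trans by meson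
qed

lemma vanishes_empty: "\<mu> {} = 0"
  using Re.vanishes_empty Im.vanishes_empty by (simp add: complex_eq_iff)

lemma Diff: "A \<in> sets M \<Longrightarrow> B \<in> sets M \<Longrightarrow> B \<subseteq> A \<Longrightarrow> \<mu> (A - B) = \<mu> A - \<mu> B"
  using Re.Diff Im.Diff by (simp add: complex_eq_iff)

lemma total_variation_eq_0_iff:
  assumes "A \<in> sets M"
  shows "total_variation M \<mu> A = 0 \<longleftrightarrow> (\<forall>B\<in>sets M. B \<subseteq> A \<longrightarrow> \<mu> B = 0)"
proof
  assume "total_variation M \<mu> A = 0"
  then show "\<forall>B\<in>sets M. B \<subseteq> A \<longrightarrow> \<mu> B = 0"
    using norm_le_total_variation[OF assms] by (metis ennreal_eq_0_iff le_zero_eq norm_le_zero_iff)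
next
  assume null: "\<forall>B\<in>sets M. B \<subseteq> A \<longrightarrow> \<mu> B = 0"
  have "(\<Sum>i. ennreal (norm (\<mu> (P i)))) = 0" if "range P \<subseteq> sets M" "(\<Union>i. P i) = A" for P :: "nat \<Rightarrow> 'a set"
  proof -
    have "\<mu> (P i) = 0" for i using null that by blast
    then show ?thesis by simp
  qed
  then have "total_variation M \<mu> A \<le> 0" unfolding total_variation_def
    by (intro SUP_least) (simp only: mem_Collect_eq)
  then show "total_variation M \<mu> A = 0" by simp
qed

end

text \<open>
  The positive and the negative part are finite measures, so bounded measurable functions are
  integrable against both, and the standard theory applies to each of the two integrals. The value
  on indicators is the Jordan decomposition.
\<close>

lemma signed_integral_functional:
  assumes "real_charge M \<nu>"
  shows "\<exists>K. sup_continuous_functional M (signed_integral M \<nu>) K"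
    and "A \<in> sets M \<Longrightarrow> signed_integral M \<nu> (indicator A) = of_real (\<nu> A)"
    and "(\<And>j. f j \<in> borel_measurable M) \<Longrightarrow> (\<And>j x. x \<in> space M \<Longrightarrow> norm (f j x) \<le> B) \<Longrightarrow>
      (\<And>x. x \<in> space M \<Longrightarrow> (\<lambda>j. f j x) \<longlonglongrightarrow> g x) \<Longrightarrow> 
      (\<lambda>j. signed_integral M \<nu> (f j)) \<longlonglongrightarrow> signed_integral M \<nu> g"
proof -
  interpret P: real_charge M \<nu> by fact
  interpret N: real_charge M "\<lambda>A. - \<nu> A" by (rule real_charge_uminus) fact
  let ?P = "positive_part M \<nu>" and ?N = "positive_part M (\<lambda>A. - \<nu> A)"
  interpret FP: finite_measure ?P by (rule P.finite_measure_positive_part)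
  interpret FN: finite_measure ?N by (rule N.finite_measure_positive_part)
  have bm: "bounded_measurable ?P = bounded_measurable M" "bounded_measurable ?N = bounded_measurable M"
    by (simp_all add: bounded_measurable_def cong: measurable_cong_sets)
  note int = FP.integrable_bounded_measurable[unfolded bm] FN.integrable_bounded_measurable[unfolded bm]
  have bound: "norm (LINT x|Q. f x) \<le> measure Q (space M) * B"
    if "finite_measure Q" "space Q = space M" "integrable Q f" "\<And>x. x \<in> space M \<Longrightarrow> norm (f x) \<le> B"
    for Q :: "'a measure" and f :: "'a \<Rightarrow> complex" and B
  proof -
    interpret finite_measure Q by fact
    have "norm (LINT x|Q. f x) \<le> (LINT x|Q. norm (f x))" by (rule integral_norm_bound)
    also have "\<dots> \<le> (LINT x|Q. B)" using that by (intro integral_mono) auto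
    finally show ?thesis using that(2) by simp
  qed
  show "\<exists>K. sup_continuous_functional M (signed_integral M \<nu>) K"
  proof (intro exI, unfold_locales)
    fix f B assume f: "f \<in> bounded_measurable M" "\<And>x. x \<in> space M \<Longrightarrow> norm (f x) \<le> B"
    have "norm (LINT x|?P. f x) \<le> measure ?P (space M) * B" "norm (LINT x|?N. f x) \<le> measure ?N (space M) * B"
      using f int by (auto intro!: bound FP.finite_measure_axioms FN.finite_measure_axioms)
    then show "norm (signed_integral M \<nu> f) \<le> (measure ?P (space M) + measure ?N (space M)) * B"
      unfolding signed_integral_def distrib_right by (intro order_trans[OF norm_triangle_ineq4] add_mono)
  qed (use int in \<open>auto simp: signed_integral_def algebra_simps\<close>)
  have ind: "(LINT x|Q. indicator A x :: complex) = of_real (measure Q A)" if "A \<in> sets Q" for Q :: "'a measure" and A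
  proof -
    have "(LINT x|Q. indicator A x :: complex) = (LINT x|Q. complex_of_real (indicator A x))"
      by (intro Bochner_Integration.integral_cong) (auto simp: indicator_def)
    also have "\<dots> = of_real (measure Q A)" using that by (simp add: Int_absorb2 sets.sets_into_space)
    finally show ?thesis .
  qed
  show "signed_integral M \<nu> (indicator A) = of_real (\<nu> A)" if "A \<in> sets M"
    using that Jordan_decomposition[OF assms that] by (simp add: signed_integral_def ind flip: of_real_diff)
  show "(\<lambda>j. signed_integral M \<nu> (f j)) \<longlonglongrightarrow> signed_integral M \<nu> g"
    if f: "\<And>j. f j \<in> borel_measurable M" "\<And>j x. x \<in> space M \<Longrightarrow> norm (f j x) \<le> B"
      "\<And>x. x \<in> space M \<Longrightarrow> (\<lambda>j. f j x) \<longlonglongrightarrow> g x"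
  proof -
    have [measurable]: "f j \<in> borel_measurable M" for j by (rule f)
    have [measurable]: "g \<in> borel_measurable M" by (rule borel_measurable_LIMSEQ_metric[OF f(1,3)])
    show ?thesis unfolding signed_integral_def using f(2,3)
      by (intro tendsto_diff integral_dominated_convergence[where w="\<lambda>_. B"] FP.integrable_const FN.integrable_const) auto
  qed
qed

context finite_complex_measure
begin

lemma complex_integral_functional: "\<exists>K. sup_continuous_functional M (complex_integral M \<mu>) K"
proof -
  obtain K L where "sup_continuous_functional M (signed_integral M (\<lambda>A. Re (\<mu> A))) K"
    "sup_continuous_functional M (signed_integral M (\<lambda>A. Im (\<mu> A))) L"
    using signed_integral_functional(1)[OF Re.real_charge_axioms] signed_integral_functional(1)[OF Im.real_charge_axioms] by auto
  then interpret R: sup_continuous_functional M "signed_integral M (\<lambda>A. Re (\<mu> A))" K +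
    I: sup_continuous_functional M "signed_integral M (\<lambda>A. Im (\<mu> A))" L by auto
  have "sup_continuous_functional M (complex_integral M \<mu>) (K + L)"
  proof
    fix f B assume "f \<in> bounded_measurable M" "0 \<le> B" "\<And>x. x \<in> space M \<Longrightarrow> norm (f x) \<le> B"
    then have "norm (signed_integral M (\<lambda>A. Re (\<mu> A)) f) \<le> K * B" "norm (signed_integral M (\<lambda>A. Im (\<mu> A)) f) \<le> L * B"
      by (auto intro: R.bound I.bound)
    then show "norm (complex_integral M \<mu> f) \<le> (K + L) * B"
      unfolding complex_integral_def distrib_right
      by (intro order_trans[OF norm_triangle_ineq] add_mono) (simp_all add: norm_mult)
  qed (auto simp: complex_integral_def R.add I.add R.cmult I.cmult algebra_simps)
  then show ?thesis by blast
qed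

lemma complex_integral_indicator: "A \<in> sets M \<Longrightarrow> complex_integral M \<mu> (indicator A) = \<mu> A"
  by (simp add: complex_integral_def signed_integral_functional(2)[OF Re.real_charge_axioms]
     signed_integral_functional(2)[OF Im.real_charge_axioms] complex_eq flip: complex_eq)

lemma complex_integral_tendsto:
  assumes "\<And>j. f j \<in> borel_measurable M" "\<And>j x. x \<in> space M \<Longrightarrow> norm (f j x) \<le> B"
    and "\<And>x. x \<in> space M \<Longrightarrow> (\<lambda>j. f j x) \<longlonglongrightarrow> g x"
  shows "(\<lambda>j. complex_integral M \<mu> (f j)) \<longlonglongrightarrow> complex_integral M \<mu> g"
  unfolding complex_integral_def
  by (intro tendsto_intros signed_integral_functional(3)[OF Re.real_charge_axioms assms]
     signed_integral_functional(3)[OF Im.real_charge_axioms assms])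

end

section \<open>Complex measures on the circle\<close>

lemma space_circle_borel [simp]: "space circle_borel = circle"
  by (simp add: circle_borel_def space_restrict_space)

lemma sets_circle_borel_iff: "A \<in> sets circle_borel \<longleftrightarrow> A \<subseteq> circle \<and> A \<in> sets borel"
  unfolding circle_borel_def by (subst sets_restrict_space_iff) auto

lemma continuous_on_circle_bounded_measurable:
  assumes "continuous_on circle f"
  shows "f \<in> bounded_measurable circle_borel"
proof -
  have "bounded (f ` circle)" using assms by (intro compact_imp_bounded compact_continuous_image) auto
  then obtain B where "\<forall>z\<in>circle. norm (f z) \<le> B" by (auto simp: bounded_iff)
  then show ?thesis using assms
    by (intro bounded_measurableI[of _ _ B]) (auto simp: circle_borel_def space_restrict_space intro: borel_measurable_continuous_on_restrict)
qed

text \<open>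
  For an open set \<open>S\<close> the indicator of \<open>S - E\<close> is a bounded pointwise
  limit of continuous functions that vanish on \<open>E\<close>, so \<open>\<mu>\<close> vanishes on
  it. The sets \<open>A\<close> for which \<open>\<mu>\<close> vanishes on \<open>A - E\<close> are
  closed under complements and disjoint unions, so Dynkin's theorem gives all Borel sets. With
  \<open>E\<close> empty this is the uniqueness of a measure with given integrals of continuous
  functions.
\<close>

lemma complex_measure_vanishes_off:
  assumes "finite_complex_measure circle_borel \<mu>" "closed E"
    and zero: "\<And>f. continuous_on circle f \<Longrightarrow> (\<And>z. z \<in> E \<inter> circle \<Longrightarrow> f z = 0) \<Longrightarrow> complex_integral circle_borel \<mu> f = 0"
    and B: "B \<in> sets circle_borel" "B \<inter> E = {}"
  shows "\<mu> B = 0"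
proof -
  interpret finite_complex_measure circle_borel \<mu> by fact
  let ?U = "circle - E"
  have U: "?U \<in> sets borel" using assms(2) by auto
  have open0: "\<mu> (S \<inter> ?U) = 0" if "open S" for S
  proof -
    (* The point 2 lies off the circle; it makes C nonempty, so that infdist vanishes only on C. *)
    define C where "C = - (S - E) \<union> {2}"
    have "open (S - E)" using that assms(2) by (rule open_Diff)
    then have C: "closed C" "C \<noteq> {}" "E \<subseteq> C" unfolding C_def by (intro closed_Un closed_Compl; simp) auto
    have CU: "circle - C = S \<inter> ?U" by (auto simp: C_def)
    define f where "f j z = complex_of_real (min 1 (real j * infdist z C))" for j z
    have cont: "continuous_on circle (f j)" for j
      unfolding f_def by (intro continuous_intros)
    have "f j z = 0" if "z \<in> E \<inter> circle" for j z using that C by (auto simp: f_def infdist_zero subsetD)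
    then have "complex_integral circle_borel \<mu> (f j) = 0" for j using cont by (intro zero) auto
    moreover have "(\<lambda>j. complex_integral circle_borel \<mu> (f j)) \<longlonglongrightarrow> complex_integral circle_borel \<mu> (indicator (S \<inter> ?U))"
    proof (rule complex_integral_tendsto)
      show "f j \<in> borel_measurable circle_borel" for j
        using continuous_on_circle_bounded_measurable[OF cont] by (rule bounded_measurable_measurable)
      show "norm (f j z) \<le> 1" for j z by (simp add: f_def infdist_nonneg)
      show "(\<lambda>j. f j z) \<longlonglongrightarrow> indicator (S \<inter> ?U) z" if z: "z \<in> space circle_borel" for z
      proof (cases "z \<in> C")
        case True
        then show ?thesis unfolding CU[symmetric] by (simp add: f_def)
      next
        case False
        then have pos: "0 < infdist z C" using C by (simp add: infdist_pos_not_in_closed)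
        obtain n where n: "1 < real n * infdist z C" using reals_Archimedean3[OF pos] by blast
        have "f j z = 1" if "j \<ge> n" for j
        proof -
          have "real n * infdist z C \<le> real j * infdist z C" using that pos by (intro mult_right_mono) auto
          then show ?thesis using n by (simp add: f_def)
        qed
        then have "eventually (\<lambda>j. f j z = 1) sequentially" by (auto simp: eventually_sequentially)
        then show ?thesis using False z unfolding CU[symmetric] by (simp add: tendsto_eventually)
      qed
    qed
    ultimately have "complex_integral circle_borel \<mu> (indicator (S \<inter> ?U)) = 0"
      by (simp add: LIMSEQ_const_iff)
    moreover have "S \<inter> ?U \<in> sets circle_borel" using that U by (auto simp: sets_circle_borel_iff)
    ultimately show ?thesis using complex_integral_indicator by simp
  qed
  have stable: "Int_stable {S :: complex set. open S}" "{S :: complex set. open S} \<subseteq> Pow UNIV"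
    by (auto simp: Int_stable_def)
  have all: "\<mu> (A \<inter> ?U) = 0" if "A \<in> sigma_sets UNIV {S. open S}" for A
    using stable that
  proof (induction rule: sigma_sets_induct_disjoint)
    case (basic A)
    then show ?case using open0 by simp
  next
    case empty
    then show ?case by (simp add: vanishes_empty)
  next
    case (compl A)
    then have "A \<in> sets borel" by (simp add: borel_def)
    then have "\<mu> (?U - A \<inter> ?U) = \<mu> ?U - \<mu> (A \<inter> ?U)" using U
      by (intro Diff) (auto simp: sets_circle_borel_iff)
    also have "?U - A \<inter> ?U = (UNIV - A) \<inter> ?U" by auto
    finally show ?case using compl open0[of UNIV] by simp
  next
    case (union A)
    have "A i \<in> sets borel" for i using union(2) by (auto simp: borel_def)
    then have "(\<lambda>i. \<mu> (A i \<inter> ?U)) sums \<mu> (\<Union>i. A i \<inter> ?U)"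
      using U union(1) by (intro sums) (auto simp: sets_circle_borel_iff disjoint_family_on_def)
    then have "\<mu> (\<Union>i. A i \<inter> ?U) = 0" unfolding union using sums_unique2 sums_zero by blast
    then show ?case by (simp add: Int_UN_distrib2)
  qed
  have "B \<in> sigma_sets UNIV {S. open S}" using B(1) by (simp add: sets_circle_borel_iff borel_def)
  moreover have "B \<inter> ?U = B" using B by (auto simp: sets_circle_borel_iff)
  ultimately show ?thesis using all by metis
qed

lemma measures_on_finite_complex: "\<mu> \<in> measures_on E \<Longrightarrow> finite_complex_measure circle_borel \<mu>"
  by (simp add: measures_on_def finite_complex_measure_def)

text \<open>
  The complement of the support is covered by open sets of variation zero, of which countably many
  suffice by the Lindelof property.
\<close>

lemma measures_on_null:
  assumes "\<mu> \<in> measures_on E" and B: "B \<in> sets circle_borel" "B \<inter> E = {}"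
  shows "\<mu> B = 0"
proof -
  interpret finite_complex_measure circle_borel \<mu> using assms(1) by (rule measures_on_finite_complex)
  define F where "F = {U. open U \<and> total_variation circle_borel \<mu> (U \<inter> circle) = 0}"
  have null: "\<mu> C = 0" if "U \<in> F" "C \<in> sets circle_borel" "C \<subseteq> U" for U C
  proof -
    have "U \<inter> circle \<in> sets circle_borel" using that by (auto simp: F_def sets_circle_borel_iff)
    then show ?thesis using that total_variation_eq_0_iff[of "U \<inter> circle"] sets_circle_borel_iff[of C] by (auto simp: F_def)
  qed
  have "B \<subseteq> \<Union>F"
  proof
    fix z assume z: "z \<in> B"
    then have "z \<in> circle" "z \<notin> measure_support \<mu>" using assms by (auto simp: sets_circle_borel_iff measures_on_def)
    then show "z \<in> \<Union>F" by (auto simp: measure_support_def F_def)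
  qed
  obtain F' where F': "F' \<subseteq> F" "countable F'" "\<Union>F' = \<Union>F"
    using Lindelof[of F] by (auto simp: F_def)
  show ?thesis
  proof (cases "F' = {}")
    case True
    then have "B = {}" using F' \<open>B \<subseteq> \<Union>F\<close> by auto
    then show ?thesis by (simp add: vanishes_empty)
  next
    case False
    define U where "U = from_nat_into F'"
    have U: "U i \<in> F" for i using F' False by (auto simp: U_def intro: from_nat_into subsetD)
    have Un: "(\<Union>i. U i) = \<Union>F" using F' False by (simp add: U_def)
    have D: "disjointed U i \<in> sets borel" for i
      using U by (auto simp: disjointed_def F_def)
    have "(\<lambda>i. \<mu> (B \<inter> disjointed U i)) sums \<mu> (\<Union>i. B \<inter> disjointed U i)"
    proof (rule sums)
      show "range (\<lambda>i. B \<inter> disjointed U i) \<subseteq> sets circle_borel"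
        using B D by (auto simp: sets_circle_borel_iff)
      show "disjoint_family (\<lambda>i. B \<inter> disjointed U i)"
        using disjoint_family_disjointed[of U] unfolding disjoint_family_on_def by blast
    qed
    moreover have "(\<Union>i. B \<inter> disjointed U i) = B"
      using \<open>B \<subseteq> \<Union>F\<close> UN_disjointed_eq[of U] Un by (metis Int_UN_distrib Int_absorb2)
    moreover have "\<mu> (B \<inter> disjointed U i) = 0" for i
      using U[of i] B D disjointed_subset[of U i] by (intro null[of "U i"]) (auto simp: sets_circle_borel_iff)
    ultimately have "(\<lambda>i::nat. 0) sums \<mu> B" by simp
    then show ?thesis using sums_unique2 sums_zero by blast
  qed
qed

section \<open>Fourier coefficients and the Bessel inequality\<close>

lemma space_circle_lebesgue [simp]: "space circle_lebesgue = circle"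
  and sets_circle_lebesgue [measurable_cong, simp]: "sets circle_lebesgue = sets circle_borel"
  by (simp_all add: circle_lebesgue_def)

lemma measurable_cis: "cis \<in> measurable lborel circle_borel"
  unfolding circle_borel_def
  by (intro measurable_restrict_space2) (auto intro!: borel_measurable_continuous_onI continuous_intros)

lemma integral_circle_lebesgue:
  fixes f :: "complex \<Rightarrow> complex"
  assumes f: "f \<in> borel_measurable circle_borel"
  shows "(LINT z|circle_lebesgue. f z) = (LINT x|lborel. indicator {0..2 * pi} x *\<^sub>R (f (cis x) / (2 * pi)))"
proof -
  have m: "(\<lambda>x. f (cis x)) \<in> borel_measurable lborel"
    using measurable_compose[OF measurable_cis f] .
  have u: "uniform_measure lborel {0..<2 * pi} = density lborel (\<lambda>x. ennreal (indicator {0..<2 * pi} x / (2 * pi)))"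
    unfolding uniform_measure_def
    by (intro density_cong) (auto simp: indicator_def divide_ennreal simp flip: ennreal_1)
  have "(LINT z|circle_lebesgue. f z) = (LINT x|uniform_measure lborel {0..<2 * pi}. f (cis x))"
    unfolding circle_lebesgue_def using measurable_cis f
    by (intro integral_distr) (auto simp: measurable_def space_uniform_measure)
  also have "\<dots> = (LINT x|lborel. (indicator {0..<2 * pi} x / (2 * pi)) *\<^sub>R f (cis x))"
    unfolding u using m by (intro integral_density) auto
  also have "\<dots> = (LINT x|lborel. indicator {0..2 * pi} x *\<^sub>R (f (cis x) / (2 * pi)))"
  proof (rule integral_cong_AE)
    show "AE x in lborel. (indicator {0..<2 * pi} x / (2 * pi)) *\<^sub>R f (cis x) =
        indicator {0..2 * pi} x *\<^sub>R (f (cis x) / (2 * pi))"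
      using AE_lborel_singleton[of "2 * pi"]
      by eventually_elim (auto simp: indicator_def scaleR_conv_of_real)
  qed (use m in measurable)
  finally show ?thesis .
qed

lemma measure_circle_lebesgue: "emeasure circle_lebesgue circle = 1"
proof -
  have "emeasure circle_lebesgue circle = emeasure (uniform_measure lborel {0..<2 * pi}) UNIV"
    unfolding circle_lebesgue_def using measurable_cis
    by (subst emeasure_distr) (auto simp: measurable_def vimage_def sets_circle_borel_iff)
  also have "\<dots> = 1" by (subst emeasure_uniform_measure) (auto simp: divide_ennreal simp flip: ennreal_1)
  finally show ?thesis .
qed

interpretation circle_lebesgue: finite_measure circle_lebesgue
  by (rule finite_measureI) (simp add: measure_circle_lebesgue)

lemma bounded_measurable_circle_lebesgue [simp]:
  "bounded_measurable circle_lebesgue = bounded_measurable circle_borel"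
  by (simp add: bounded_measurable_def cong: measurable_cong_sets)

lemma integrable_circle_lebesgue: "f \<in> bounded_measurable circle_borel \<Longrightarrow> integrable circle_lebesgue f"
  using circle_lebesgue.integrable_bounded_measurable by simp

lemma circle_nonzero: "z \<in> circle \<Longrightarrow> z \<noteq> 0"
  by auto

lemma cnj_powi_circle:
  assumes "z \<in> circle"
  shows "cnj (z powi n) = z powi (- n)"
proof -
  have "z * cnj z = 1" using assms by (simp add: complex_norm_square[symmetric])
  then have "cnj z = inverse z" by (simp add: inverse_unique)
  then show ?thesis by (simp add: power_int_inverse power_int_minus)
qed

lemma powi_mult_circle: "z \<in> circle \<Longrightarrow> z powi m * z powi n = z powi (m + n)"
  using circle_nonzero[of z] by (simp add: power_int_add)

lemma continuous_on_powi_circle: "continuous_on circle (\<lambda>z. z powi n)"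
  by (intro continuous_intros) auto

lemma bounded_measurable_powi [simp]: "(\<lambda>z. z powi n) \<in> bounded_measurable circle_borel"
  by (intro continuous_on_circle_bounded_measurable continuous_on_powi_circle)

lemma integral_powi_circle: "(LINT z|circle_lebesgue. z powi n) = of_bool (n = 0)"
proof (cases "n = 0")
  case True
  then show ?thesis using measure_circle_lebesgue by (simp add: measure_def)
next
  case False
  define F where "F x = cis (of_int n * x) / (\<i> * of_int n * 2 * pi)" for x
  have "(LINT z|circle_lebesgue. z powi n) = (LINT x|lborel. indicator {0..2 * pi} x *\<^sub>R (cis (of_int n * x) / (2 * pi)))"
    by (subst integral_circle_lebesgue) (auto simp: cis_power_int intro: bounded_measurable_measurable)
  also have "\<dots> = F (2 * pi) - F 0"
  proof (rule integral_FTC_Icc)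
    show "(F has_vector_derivative cis (of_int n * x) / (2 * pi)) (at x within {0..2 * pi})" for x
      unfolding F_def has_vector_derivative_def using False
      by (auto intro!: derivative_eq_intros simp: scaleR_conv_of_real field_simps)
  qed (auto intro!: continuous_intros)
  also have "\<dots> = 0"
    using cis_multiple_2pi[of "of_int n"] by (simp add: F_def mult_ac)
  finally show ?thesis using False by simp
qed

abbreviation fourier :: "(complex \<Rightarrow> complex) \<Rightarrow> int \<Rightarrow> complex" where
  "fourier f \<equiv> fourier_coeff (function_distribution f)"

lemma fourier_eq: "fourier f n = (LINT z|circle_lebesgue. z powi (- n) * f z)"
  by (simp add: fourier_coeff_def function_distribution_def)

lemma fourier_add:
  assumes "f \<in> bounded_measurable circle_borel" "g \<in> bounded_measurable circle_borel"
  shows "fourier (\<lambda>z. f z + g z) n = fourier f n + fourier g n"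
proof -
  have "integrable circle_lebesgue (\<lambda>z. z powi (- n) * f z)" "integrable circle_lebesgue (\<lambda>z. z powi (- n) * g z)"
    using assms by (auto intro!: integrable_circle_lebesgue bounded_measurable_mult)
  then show ?thesis by (simp add: fourier_eq distrib_left)
qed

lemma fourier_cmult: "fourier (\<lambda>z. c * f z) n = c * fourier f n"
  unfolding fourier_eq by (subst mult.left_commute) simp

lemma fourier_powi: "fourier (\<lambda>z. z powi k) n = of_bool (n = k)"
proof -
  have "fourier (\<lambda>z. z powi k) n = (LINT z|circle_lebesgue. z powi (k - n))"
    unfolding fourier_eq
    by (intro Bochner_Integration.integral_cong) (auto simp: powi_mult_circle)
  then show ?thesis by (auto simp: integral_powi_circle)
qed

text \<open>
  Expand the squared distance of \<open>f\<close> from its partial Fourier sum \<open>g\<close>.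
  Both \<open>\<integral> f * cnj g\<close> and \<open>\<integral> g * cnj g\<close> are equal to
  the sum of the squares of the coefficients, by orthonormality of the monomials.
\<close>

lemma Bessel_finite:
  assumes f: "f \<in> bounded_measurable circle_borel" and F: "finite F"
  shows "(\<Sum>n\<in>F. norm (fourier f n) ^ 2) \<le> (LINT z|circle_lebesgue. norm (f z) ^ 2)"
proof -
  define g where "g z = (\<Sum>n\<in>F. fourier f n * z powi n)" for z
  have g: "g \<in> bounded_measurable circle_borel"
    unfolding g_def by (intro bounded_measurable_sum bounded_measurable_cmult) auto
  have cnj_bm: "(\<lambda>z. cnj (h z)) \<in> bounded_measurable circle_borel" if h: "h \<in> bounded_measurable circle_borel" for h
  proof -
    obtain B where "\<And>z. z \<in> space circle_borel \<Longrightarrow> norm (h z) \<le> B" using bounded_measurableE[OF h] by blast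
    moreover have "(\<lambda>z. cnj (h z)) \<in> borel_measurable circle_borel"
      by (rule measurable_compose[OF bounded_measurable_measurable[OF h]])
        (auto intro!: borel_measurable_continuous_onI continuous_intros)
    ultimately show ?thesis by (intro bounded_measurableI[of _ _ B]) auto
  qed
  have inner: "(LINT z|circle_lebesgue. h z * cnj (g z)) = (\<Sum>n\<in>F. cnj (fourier f n) * fourier h n)"
    if h: "h \<in> bounded_measurable circle_borel" for h
  proof -
    have "(LINT z|circle_lebesgue. h z * cnj (g z)) =
        (LINT z|circle_lebesgue. (\<Sum>n\<in>F. cnj (fourier f n) * (z powi (- n) * h z)))"
      by (intro Bochner_Integration.integral_cong)
        (auto simp: g_def cnj_powi_circle sum_distrib_left mult_ac simp del: complex_cnj_power_int intro!: sum.cong)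
    also have "\<dots> = (\<Sum>n\<in>F. (LINT z|circle_lebesgue. cnj (fourier f n) * (z powi (- n) * h z)))"
      using h by (intro Bochner_Integration.integral_sum integrable_circle_lebesgue bounded_measurable_mult) auto
    finally show ?thesis by (simp add: fourier_eq)
  qed
  have fg: "fourier g n = fourier f n" if "n \<in> F" for n
  proof -
    have "fourier g n = (\<Sum>m\<in>F. fourier f m * fourier (\<lambda>z. z powi m) n)"
    proof -
      have "fourier g n = (LINT z|circle_lebesgue. (\<Sum>m\<in>F. fourier f m * (z powi (- n) * z powi m)))"
        unfolding fourier_eq[of g] by (intro Bochner_Integration.integral_cong) (auto simp: g_def sum_distrib_left mult_ac)
      also have "\<dots> = (\<Sum>m\<in>F. (LINT z|circle_lebesgue. fourier f m * (z powi (- n) * z powi m)))"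
        by (intro Bochner_Integration.integral_sum integrable_circle_lebesgue bounded_measurable_mult) auto
      finally show ?thesis by (simp add: fourier_eq)
    qed
    also have "\<dots> = fourier f n"
      using F that by (simp add: fourier_powi if_distrib cong: if_cong)
    finally show ?thesis .
  qed
  let ?S = "\<Sum>n\<in>F. norm (fourier f n) ^ 2"
  have S: "(\<Sum>n\<in>F. cnj (fourier f n) * fourier f n) = of_real ?S"
    unfolding of_real_sum complex_norm_square by (simp add: mult.commute)
  have fcg: "(LINT z|circle_lebesgue. f z * cnj (g z)) = of_real ?S"
    using inner[OF f] S by simp
  have gcg: "(LINT z|circle_lebesgue. g z * cnj (g z)) = of_real ?S"
    using inner[OF g] S fg by simp
  have fcf: "(LINT z|circle_lebesgue. f z * cnj (f z)) = of_real (LINT z|circle_lebesgue. norm (f z) ^ 2)"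
    by (simp flip: complex_norm_square integral_complex_of_real)
  note int = integrable_circle_lebesgue[OF bounded_measurable_mult[OF _ cnj_bm]]
  have "of_real (LINT z|circle_lebesgue. norm (f z - g z) ^ 2)
      = (LINT z|circle_lebesgue. (f z - g z) * cnj (f z - g z))"
    by (simp only: complex_norm_square[symmetric] integral_complex_of_real)
  also have "\<dots> = (LINT z|circle_lebesgue. f z * cnj (f z) - f z * cnj (g z) - cnj (f z * cnj (g z)) + g z * cnj (g z))"
    by (intro Bochner_Integration.integral_cong) (auto simp: algebra_simps)
  also have "\<dots> = of_real ((LINT z|circle_lebesgue. norm (f z) ^ 2) - ?S - ?S + ?S)"
    using f g int fcg gcg fcf
    by (simp del: complex_cnj_mult add: cnj_bm bounded_measurable_mult integrable_circle_lebesgue)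
  finally have "(LINT z|circle_lebesgue. norm (f z - g z) ^ 2) = (LINT z|circle_lebesgue. norm (f z) ^ 2) - ?S"
    by (simp only: of_real_eq_iff)
  moreover have "0 \<le> (LINT z|circle_lebesgue. norm (f z - g z) ^ 2)"
    by (rule Bochner_Integration.integral_nonneg) simp
  ultimately show ?thesis by simp
qed

lemma Bessel:
  assumes f: "f \<in> bounded_measurable circle_borel"
  shows "fourier f \<in> lp_space 2" "power_sum 2 (fourier f) \<le> (LINT z|circle_lebesgue. norm (f z) ^ 2)"
proof -
  have *: "(\<Sum>n\<in>F. norm (fourier f n) powr 2) \<le> (LINT z|circle_lebesgue. norm (f z) ^ 2)" if "finite F" for F
    using Bessel_finite[OF f that] by simp
  show "fourier f \<in> lp_space 2" "power_sum 2 (fourier f) \<le> (LINT z|circle_lebesgue. norm (f z) ^ 2)"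
    by (rule lp_space_from_finite_sums, erule *)+
qed

text \<open>
  For square-summable \<open>b\<close> this is the integral of \<open>f\<close> against the measure
  with Fourier coefficients \<open>b (- n)\<close>, written on the Fourier side.
\<close>

definition pairing :: "(int \<Rightarrow> complex) \<Rightarrow> (complex \<Rightarrow> complex) \<Rightarrow> complex" where
  "pairing b f = (\<Sum>\<^sub>\<infinity>n. b n * fourier f n)"

text \<open>
  Cauchy-Schwarz for sequences followed by the Bessel inequality. The bound by the mean square of
  \<open>f\<close>, and not only by its supremum, is what makes the pairing countably additive on
  indicators.
\<close>

lemma pairing_L2_bound:
  assumes b: "b \<in> lp_space 2" and f: "f \<in> bounded_measurable circle_borel"
  shows "norm (pairing b f) \<le> sqrt (power_sum 2 b) * sqrt (LINT z|circle_lebesgue. norm (f z) ^ 2)"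
proof -
  have "norm (pairing b f) \<le> power_sum 2 b powr (1/2) * power_sum 2 (fourier f) powr (1/2)"
    unfolding pairing_def using b Bessel(1)[OF f] by (intro Holder_inequality) auto
  also have "\<dots> = sqrt (power_sum 2 b) * sqrt (power_sum 2 (fourier f))"
    by (simp add: powr_half_sqrt power_sum_nonneg)
  also have "\<dots> \<le> sqrt (power_sum 2 b) * sqrt (LINT z|circle_lebesgue. norm (f z) ^ 2)"
    using Bessel(2)[OF f] by (intro mult_left_mono) (auto simp: power_sum_nonneg)
  finally show ?thesis .
qed

lemma pairing_functional:
  assumes b: "b \<in> lp_space 2"
  shows "sup_continuous_functional circle_borel (pairing b) (sqrt (power_sum 2 b))"
proof
  fix f g assume fg: "f \<in> bounded_measurable circle_borel" "g \<in> bounded_measurable circle_borel"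
  show "pairing b (\<lambda>z. f z + g z) = pairing b f + pairing b g"
    using pairing_linear[of 2 2 b "fourier f" "fourier g" 1 1] b Bessel(1) fg
    by (simp add: pairing_def fourier_add)
next
  fix f c assume "f \<in> bounded_measurable circle_borel"
  show "pairing b (\<lambda>z. c * f z) = c * pairing b f"
    unfolding pairing_def fourier_cmult by (subst mult.left_commute) (rule infsum_cmult_right')
next
  fix f B assume f: "f \<in> bounded_measurable circle_borel" "0 \<le> B" "\<And>z. z \<in> space circle_borel \<Longrightarrow> norm (f z) \<le> B"
  have "(LINT z|circle_lebesgue. norm (f z) ^ 2) \<le> (LINT z|circle_lebesgue. B ^ 2)"
  proof (rule integral_mono)
    have "(\<lambda>z. norm (f z) ^ 2) \<in> borel_measurable circle_lebesgue"
      using bounded_measurable_measurable[OF f(1)] by (simp cong: measurable_cong_sets)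
    then show "integrable circle_lebesgue (\<lambda>z. norm (f z) ^ 2)"
      using f by (intro circle_lebesgue.integrable_const_bound[of _ "B^2"] AE_I2) (auto simp: power_mono)
  qed (use f in \<open>auto intro: power_mono\<close>)
  also have "\<dots> = B ^ 2" using measure_circle_lebesgue by (simp add: measure_def)
  finally have "sqrt (LINT z|circle_lebesgue. norm (f z) ^ 2) \<le> B" using f(2) by (intro real_le_lsqrt) auto
  then have "sqrt (power_sum 2 b) * sqrt (LINT z|circle_lebesgue. norm (f z) ^ 2) \<le> sqrt (power_sum 2 b) * B"
    by (intro mult_left_mono) (auto simp: power_sum_nonneg)
  then show "norm (pairing b f) \<le> sqrt (power_sum 2 b) * B"
    using pairing_L2_bound[OF b f(1)] by linarith
qed

lemma pairing_powi: "pairing b (\<lambda>z. z powi k) = b k"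
proof -
  have "pairing b (\<lambda>z. z powi k) = (\<Sum>\<^sub>\<infinity>n\<in>{k}. b n * of_bool (n = k))"
    unfolding pairing_def fourier_powi by (rule infsum_cong_neutral) auto
  then show ?thesis by simp
qed

section \<open>Density of trigonometric polynomials\<close>

text \<open>
  The last rule is there because multiplication and conjugation of monomials use the identities
  \<open>z powi m * z powi n = z powi (m + n)\<close> and \<open>cnj z = z powi (- 1)\<close>, for
  which \<open>z\<close> has to be on the circle.
\<close>

inductive trig_poly :: "(complex \<Rightarrow> complex) \<Rightarrow> bool" where
  monomial: "trig_poly (\<lambda>z. c * z powi n)"
| add: "trig_poly f \<Longrightarrow> trig_poly g \<Longrightarrow> trig_poly (\<lambda>z. f z + g z)"
| cong: "trig_poly f \<Longrightarrow> (\<And>z. z \<in> circle \<Longrightarrow> g z = f z) \<Longrightarrow> trig_poly g"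

lemma trig_poly_const: "trig_poly (\<lambda>z. c)"
  using trig_poly.monomial[of c 0] by simp

lemma trig_poly_mult:
  assumes "trig_poly f" "trig_poly g"
  shows "trig_poly (\<lambda>z. f z * g z)"
  using assms(1)
proof induction
  case (monomial c n)
  show ?case using assms(2)
  proof induction
    case (monomial d m)
    show ?case
      by (rule trig_poly.cong[OF trig_poly.monomial[of "c * d" "n + m"]]) (auto simp flip: powi_mult_circle)
  next
    case (add f g)
    then show ?case by (simp add: distrib_left trig_poly.add)
  next
    case (cong f g)
    show ?case by (rule trig_poly.cong[OF cong(3)]) (simp add: cong(2))
  qed
next
  case (add f f')
  then show ?case by (simp add: distrib_right trig_poly.add)
next
  case (cong f f')
  show ?case by (rule trig_poly.cong[OF cong(3)]) (simp add: cong(2))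
qed

text \<open>
  On the circle a real linear function of \<open>z\<close> is a combination of \<open>z\<close> and
  \<open>cnj z = z powi (- 1)\<close>.
\<close>

lemma trig_poly_real_polynomial_function:
  assumes "real_polynomial_function f"
  shows "trig_poly (\<lambda>z. complex_of_real (f z))"
  using assms
proof induction
  case (linear f)
  interpret bounded_linear f by fact
  let ?a = "(of_real (f 1) - \<i> * of_real (f \<i>)) / 2" and ?b = "(of_real (f 1) + \<i> * of_real (f \<i>)) / 2"
  show ?case
  proof (rule trig_poly.cong[OF trig_poly.add[OF trig_poly.monomial[of ?a 1] trig_poly.monomial[of ?b "-1"]]])
    fix z :: complex assume z: "z \<in> circle"
    have "z = Re z *\<^sub>R 1 + Im z *\<^sub>R \<i>" by (simp add: complex_eq_iff)
    then have "f z = f (Re z *\<^sub>R 1 + Im z *\<^sub>R \<i>)" by (rule arg_cong)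
    also have "\<dots> = Re z * f 1 + Im z * f \<i>" by (simp only: add scaleR real_scaleR_def)
    finally have fz: "f z = Re z * f 1 + Im z * f \<i>" .
    have m: "z powi (-1) = cnj z" using cnj_powi_circle[OF z, of 1] by simp
    show "complex_of_real (f z) = ?a * z powi 1 + ?b * z powi (-1)"
      unfolding m fz by (simp add: complex_eq_iff field_simps)
  qed
qed (auto intro: trig_poly_const trig_poly.add trig_poly_mult)

lemma trig_poly_dense:
  assumes "continuous_on circle f" "0 < e"
  shows "\<exists>g. trig_poly g \<and> (\<forall>z\<in>circle. norm (f z - g z) < e)"
proof -
  obtain g where g: "polynomial_function g" "\<forall>z\<in>circle. norm (f z - g z) < e"
    using Stone_Weierstrass_polynomial_function[OF _ assms] by auto
  have "real_polynomial_function (\<lambda>z. Re (g z))" "real_polynomial_function (\<lambda>z. Im (g z))"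
    using g(1) bounded_linear_Re bounded_linear_Im unfolding polynomial_function_def o_def by auto
  then have "trig_poly (\<lambda>z. of_real (Re (g z)) + \<i> * of_real (Im (g z)))"
    by (intro trig_poly.add trig_poly_mult trig_poly_const trig_poly_real_polynomial_function)
  then have "trig_poly g" by (simp add: complex_eq[symmetric])
  with g(2) show ?thesis by blast
qed

lemma trig_poly_continuous: "trig_poly f \<Longrightarrow> continuous_on circle f"
proof (induction rule: trig_poly.induct)
  case (cong f g)
  then show ?case using continuous_on_cong[OF refl, of circle g f] by simp
qed (auto intro!: continuous_intros)

lemma sup_continuous_functional_eq_on_monomials:
  assumes S: "sup_continuous_functional circle_borel S K" and T: "sup_continuous_functional circle_borel T L"
    and mono: "\<And>n. S (\<lambda>z. z powi n) = T (\<lambda>z. z powi n)"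
    and f: "continuous_on circle f"
  shows "S f = T f"
proof -
  interpret S: sup_continuous_functional circle_borel S K by fact
  interpret T: sup_continuous_functional circle_borel T L by fact
  have trig: "S g = T g" if "trig_poly g" for g
    using that
  proof induction
    case (monomial c n)
    then show ?case by (simp add: S.cmult T.cmult mono)
  next
    case (add f g)
    then show ?case
      by (simp add: S.add T.add continuous_on_circle_bounded_measurable trig_poly_continuous)
  next
    case (cong f g)
    have bm: "f \<in> bounded_measurable circle_borel" "g \<in> bounded_measurable circle_borel"
      using trig_poly_continuous[OF cong(1)] trig_poly_continuous[OF trig_poly.cong[OF cong(1,2)]]
      by (auto intro: continuous_on_circle_bounded_measurable)
    have "S g = S f" using bm cong(2) by (intro S.cong) auto
    moreover have "T g = T f" using bm cong(2) by (intro T.cong) auto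
    ultimately show ?case using cong(3) by simp
  qed
  show ?thesis
  proof (rule sup_continuous_functional_eqI[OF S T continuous_on_circle_bounded_measurable[OF f]])
    fix e :: real assume "0 < e"
    then obtain g where "trig_poly g" "\<forall>z\<in>circle. norm (f z - g z) < e" using trig_poly_dense[OF f] by blast
    then show "\<exists>g\<in>bounded_measurable circle_borel. S g = T g \<and> (\<forall>x\<in>space circle_borel. norm (f x - g x) \<le> e)"
      by (intro bexI[of _ g])
       (auto simp: trig less_imp_le intro: continuous_on_circle_bounded_measurable trig_poly_continuous)
  qed
qed

section \<open>Measures with square-summable Fourier coefficients\<close>

lemma power_sum_reindex: 
  fixes g :: "int \<Rightarrow> int" assumes "bij g"
  shows "(\<lambda>n. a (g n)) \<in> lp_space s \<longleftrightarrow> a \<in> lp_space s" "power_sum s (\<lambda>n. a (g n)) = power_sum s a"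
  using assms by (auto simp: lp_space_def power_sum_def
     intro!: summable_on_reindex_bij_betw[where f="\<lambda>n. norm (a n) powr s"] infsum_reindex_bij_betw[where f="\<lambda>n. norm (a n) powr s"])

lemma bij_uminus_int: "bij (uminus :: int \<Rightarrow> int)"
  by (rule o_bij[of uminus]) auto

text \<open>
  The measure whose Fourier coefficients are \<open>b (- n)\<close>. Since the pairing makes sense
  for every bounded measurable function, the measure is read off from indicators.
\<close>

definition pairing_measure :: "(int \<Rightarrow> complex) \<Rightarrow> complex set \<Rightarrow> complex" where
  "pairing_measure b A = pairing b (indicator A)"

text \<open>
  Countable additivity: the error after \<open>n\<close> sets is the pairing with the indicator of
  the remaining union, which is small in mean square. Finite variation: the sum of the absolute
  values of the measure over a partition is the pairing with a step function that takes unimodular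
  values or zero.
\<close>

lemma finite_complex_measure_pairing_measure:
  assumes b: "b \<in> lp_space 2"
  shows "finite_complex_measure circle_borel (pairing_measure b)"
proof
  interpret P: sup_continuous_functional circle_borel "pairing b" "sqrt (power_sum 2 b)"
    by (rule pairing_functional[OF b])
  show "complex_measure circle_borel (pairing_measure b)"
    unfolding complex_measure_def sums_def
  proof (intro allI impI)
    fix A :: "nat \<Rightarrow> complex set" assume A: "range A \<subseteq> sets circle_borel" "disjoint_family A"
    let ?U = "\<lambda>n. \<Union>i\<in>{n..}. A i"
    have U: "?U n \<in> sets circle_borel" for n using A by auto
    have split: "pairing_measure b (\<Union>i. A i) - (\<Sum>i<n. pairing_measure b (A i)) = pairing b (indicator (?U n))" for n
    proof -
      have "(\<lambda>z. indicator (\<Union>i. A i) z - (\<Sum>i<n. indicator (A i) z)) = (indicator (?U n) :: complex \<Rightarrow> complex)"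
      proof
        fix z
        have "(\<Sum>i<n. indicator (A i) z) = (indicator (\<Union>i<n. A i) z :: complex)"
          using A(2) by (intro indicator_UN_disjoint[symmetric] disjoint_family_on_mono[OF _ A(2)]) auto
        moreover have "z \<notin> (\<Union>i<n. A i) \<or> z \<notin> ?U n"
          using disjoint_family_onD[OF A(2)] by (metis (no_types, lifting) UN_E UNIV_I atLeast_iff disjoint_iff lessThan_iff not_le)
        moreover have "z \<in> (\<Union>i. A i) \<longleftrightarrow> z \<in> (\<Union>i<n. A i) \<or> z \<in> ?U n" by auto (metis atLeast_iff lessThan_iff linorder_not_le)
        ultimately show "indicator (\<Union>i. A i) z - (\<Sum>i<n. indicator (A i) z) = (indicator (?U n) z :: complex)"
          by (auto simp: indicator_def)
      qed
      moreover have "pairing b (\<lambda>z. indicator (\<Union>i. A i) z - (\<Sum>i<n. indicator (A i) z)) =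
          pairing b (indicator (\<Union>i. A i)) - (\<Sum>i<n. pairing b (indicator (A i)))"
        using A by (subst P.diff, simp, intro bounded_measurable_sum, force, subst P.sum) auto
      ultimately show ?thesis by (simp add: pairing_measure_def)
    qed
    have bound: "norm (pairing b (indicator (?U n))) \<le> sqrt (power_sum 2 b) * sqrt (measure circle_lebesgue (?U n))" for n
    proof -
      have "(LINT z|circle_lebesgue. norm (indicator (?U n) z :: complex) ^ 2) = (LINT z|circle_lebesgue. indicator (?U n) z)"
        by (intro Bochner_Integration.integral_cong) (auto simp: indicator_def)
      also have "\<dots> = measure circle_lebesgue (?U n)"
        using U[of n] by (simp add: Int_absorb2 sets_circle_borel_iff)
      finally show ?thesis
        using pairing_L2_bound[OF b bounded_measurable_indicator[OF U[of n]]] by simp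
    qed
    have "(\<Inter>n. ?U n) = {}"
    proof -
      have "z \<notin> (\<Inter>n. ?U n)" for z
      proof
        assume z: "z \<in> (\<Inter>n. ?U n)"
        then obtain i where i: "z \<in> A i" by auto
        from z have "z \<in> ?U (Suc i)" by blast
        then obtain j where "j > i" "z \<in> A j" by (auto simp: Suc_le_eq)
        then show False using i disjoint_family_onD[OF A(2), of i j] by auto
      qed
      then show ?thesis by blast
    qed
    then have "(\<lambda>n. measure circle_lebesgue (?U n)) \<longlonglongrightarrow> 0"
      using circle_lebesgue.finite_Lim_measure_decseq[of ?U] U by (force simp: decseq_def)
    then have "(\<lambda>n. sqrt (power_sum 2 b) * sqrt (measure circle_lebesgue (?U n))) \<longlonglongrightarrow> sqrt (power_sum 2 b) * sqrt 0"
      by (intro tendsto_intros)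
    then have "(\<lambda>n. pairing b (indicator (?U n))) \<longlonglongrightarrow> 0"
      using bound by (intro Lim_null_comparison[of "\<lambda>n. pairing b (indicator (?U n))"]) (auto simp: eventually_sequentially)
    then have "(\<lambda>n. pairing_measure b (\<Union>i. A i) - pairing b (indicator (?U n))) \<longlonglongrightarrow> pairing_measure b (\<Union>i. A i) - 0"
      by (intro tendsto_intros)
    then show "(\<lambda>n. \<Sum>i<n. pairing_measure b (A i)) \<longlonglongrightarrow> pairing_measure b (\<Union>i. A i)"
      by (simp flip: split)
  qed
  have "total_variation circle_borel (pairing_measure b) circle \<le> ennreal (sqrt (power_sum 2 b))"
    unfolding total_variation_def
  proof (rule SUP_least)
    fix A :: "nat \<Rightarrow> complex set"
    assume "A \<in> {P. range P \<subseteq> sets circle_borel \<and> disjoint_family P \<and> \<Union> (range P) = circle}"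
    then have A: "A i \<in> sets circle_borel" "disjoint_family A" for i by auto
    have "(\<Sum>i<n. norm (pairing_measure b (A i))) \<le> sqrt (power_sum 2 b)" for n
    proof -
      (* These factors turn each summand into its absolute value. *)
      define \<epsilon> where "\<epsilon> i = cnj (sgn (pairing_measure b (A i)))" for i
      define f where "f z = (\<Sum>i<n. \<epsilon> i * indicator (A i) z)" for z
      have bm: "(\<lambda>z. \<epsilon> i * indicator (A i) z) \<in> bounded_measurable circle_borel" for i
        using A by (intro bounded_measurable_cmult) auto
      have "norm (f z) \<le> 1" for z
      proof -
        have "norm (\<epsilon> i * indicator (A i) z) \<le> indicator (A i) z" for i
          by (auto simp: norm_mult \<epsilon>_def norm_sgn indicator_def)
        then have "norm (f z) \<le> (\<Sum>i<n. indicator (A i) z)"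
          unfolding f_def by (intro order_trans[OF norm_sum sum_mono])
        also have "\<dots> = indicator (\<Union>i<n. A i) z"
          using A(2) by (intro indicator_UN_disjoint[symmetric] disjoint_family_on_mono[OF _ A(2)]) auto
        also have "\<dots> \<le> 1" by (simp add: indicator_def)
        finally show ?thesis .
      qed
      moreover have "f \<in> bounded_measurable circle_borel"
        unfolding f_def using bm by (intro bounded_measurable_sum)
      ultimately have "norm (pairing b f) \<le> sqrt (power_sum 2 b) * 1" by (intro P.bound) auto
      moreover have "pairing b f = of_real (\<Sum>i<n. norm (pairing_measure b (A i)))"
      proof -
        have "pairing b f = (\<Sum>i<n. \<epsilon> i * pairing_measure b (A i))"
          unfolding f_def using bm A
          by (subst P.sum) (auto simp: P.cmult pairing_measure_def simp del: sum_mult_indicator)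
        moreover have "cnj (sgn w) * w = of_real (norm w)" for w :: complex
          using duality_map_mult_self[of 1 w] by (cases "w = 0") (simp_all add: duality_map_def)
        ultimately show ?thesis by (simp add: \<epsilon>_def)
      qed
      ultimately show ?thesis by (simp add: sum_nonneg del: of_real_sum)
    qed
    then show "(\<Sum>i. ennreal (norm (pairing_measure b (A i)))) \<le> ennreal (sqrt (power_sum 2 b))"
      by (intro suminf_le_const ennreal_leI) (auto simp: sum_ennreal ennreal_leI)
  qed
  then have "total_variation circle_borel (pairing_measure b) circle < top"
    by (rule order_le_less_trans) (rule ennreal_less_top)
  then show "total_variation circle_borel (pairing_measure b) (space circle_borel) < \<infinity>" by simp
qed

lemma complex_integral_pairing_measure:
  assumes b: "b \<in> lp_space 2" and f: "f \<in> bounded_measurable circle_borel"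
  shows "complex_integral circle_borel (pairing_measure b) f = pairing b f"
proof -
  interpret finite_complex_measure circle_borel "pairing_measure b"
    by (rule finite_complex_measure_pairing_measure[OF b])
  obtain K where "sup_continuous_functional circle_borel (complex_integral circle_borel (pairing_measure b)) K"
    using complex_integral_functional by blast
  from sup_continuous_functional_eq_on_indicators[OF this pairing_functional[OF b] _ f]
  show ?thesis by (simp add: complex_integral_indicator pairing_measure_def)
qed

lemma fourier_coeff_pairing_measure:
  assumes "b \<in> lp_space 2"
  shows "fourier_coeff (measure_distribution (pairing_measure b)) n = b (- n)"
  using complex_integral_pairing_measure[OF assms, of "\<lambda>z. z powi (- n)"]
  by (simp add: fourier_coeff_def measure_distribution_def pairing_powi)

text \<open>
  Parseval's formula. Both sides are bounded in the supremum norm and agree on monomials, hence on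
  the closure of the trigonometric polynomials.
\<close>

lemma complex_integral_eq_pairing:
  assumes "finite_complex_measure circle_borel \<mu>" "fourier_coeff (measure_distribution \<mu>) \<in> lp_space 2"
    and f: "continuous_on circle f"
  shows "complex_integral circle_borel \<mu> f = pairing (\<lambda>n. fourier_coeff (measure_distribution \<mu>) (- n)) f"
proof -
  interpret finite_complex_measure circle_borel \<mu> by fact
  let ?b = "\<lambda>n. fourier_coeff (measure_distribution \<mu>) (- n)"
  have b: "?b \<in> lp_space 2" using assms(2) power_sum_reindex(1)[OF bij_uminus_int] by auto
  obtain K where K: "sup_continuous_functional circle_borel (complex_integral circle_borel \<mu>) K"
    using complex_integral_functional by blast
  show ?thesis
    by (rule sup_continuous_functional_eq_on_monomials[OF K pairing_functional[OF b] _ f])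
      (simp add: pairing_powi, simp add: fourier_coeff_def measure_distribution_def)
qed

text \<open>
  Integrating \<open>h\<close> and integrating \<open>h\<close> times the indicator of
  \<open>E\<close> agree on indicators, because \<open>\<mu>\<close> vanishes off \<open>E\<close>,
  and therefore on all bounded measurable functions.
\<close>

lemma complex_integral_eqI_on_support:
  assumes \<mu>: "\<mu> \<in> measures_on E" and "E \<in> sets circle_borel"
    and f: "f \<in> bounded_measurable circle_borel" and g: "g \<in> bounded_measurable circle_borel"
    and eq: "\<And>z. z \<in> E \<Longrightarrow> f z = g z"
  shows "complex_integral circle_borel \<mu> f = complex_integral circle_borel \<mu> g"
proof -
  interpret finite_complex_measure circle_borel \<mu> using \<mu> by (rule measures_on_finite_complex)
  obtain K where K: "sup_continuous_functional circle_borel (complex_integral circle_borel \<mu>) K"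
    using complex_integral_functional by blast
  interpret T: sup_continuous_functional circle_borel "complex_integral circle_borel \<mu>" K by (rule K)
  let ?T = "\<lambda>h. complex_integral circle_borel \<mu> (\<lambda>z. indicator E z * h z)"
  have bm: "(\<lambda>z. indicator E z * h z) \<in> bounded_measurable circle_borel" if "h \<in> bounded_measurable circle_borel" for h
    using that assms(2) by (intro bounded_measurable_mult) auto
  have T: "sup_continuous_functional circle_borel ?T K"
  proof
    fix h k assume hk: "h \<in> bounded_measurable circle_borel" "k \<in> bounded_measurable circle_borel"
    show "?T (\<lambda>z. h z + k z) = ?T h + ?T k"
      using T.add[OF bm[OF hk(1)] bm[OF hk(2)]] by (simp add: distrib_left)
  next
    fix h c assume h: "h \<in> bounded_measurable circle_borel"
    show "?T (\<lambda>z. c * h z) = c * ?T h"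
      using T.cmult[OF bm[OF h], of c] by (simp add: mult.left_commute)
  next
    fix h B assume h: "h \<in> bounded_measurable circle_borel" "0 \<le> B" "\<And>z. z \<in> space circle_borel \<Longrightarrow> norm (h z) \<le> B"
    show "norm (?T h) \<le> K * B"
      by (rule T.bound[OF bm[OF h(1)]]) (use h(2,3) in \<open>auto simp: indicator_def\<close>)
  qed
  have "complex_integral circle_borel \<mu> h = ?T h" if "h \<in> bounded_measurable circle_borel" for h
  proof (rule sup_continuous_functional_eq_on_indicators[OF K T _ that])
    fix A assume A: "A \<in> sets circle_borel"
    have "\<mu> (A - E) = 0" using A assms(2) by (intro measures_on_null[OF \<mu>]) auto
    moreover have "\<mu> (A - A \<inter> E) = \<mu> A - \<mu> (A \<inter> E)" using A assms(2) by (intro Diff) auto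
    moreover have "A - A \<inter> E = A - E" by auto
    moreover have "(\<lambda>z. indicator E z * indicator A z :: complex) = indicator (A \<inter> E)"
      by (auto simp: indicator_def)
    ultimately show "complex_integral circle_borel \<mu> (indicator A) = ?T (indicator A)"
      using A assms(2) by (simp add: complex_integral_indicator)
  qed
  moreover have "(\<lambda>z. indicator E z * f z) = (\<lambda>z. indicator E z * g z)"
    using eq by (auto simp: indicator_def)
  ultimately show ?thesis using f g by simp
qed

section \<open>The capacity and its dual description\<close>

lemma lp_norm_eq: "a \<in> lp_space s \<Longrightarrow> lp_norm s a = ennreal (power_sum s a powr (1 / s))"
  by (simp add: lp_norm_def power_sum_def)

lemma lp_norm_le_1D:
  assumes "0 < s" "lp_norm s a \<le> 1"
  shows "a \<in> lp_space s" "power_sum s a powr (1 / s) \<le> 1"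
proof -
  show a: "a \<in> lp_space s" using assms by (auto simp: lp_norm_def top_unique split: if_splits)
  show "power_sum s a powr (1 / s) \<le> 1" using assms by (simp add: lp_norm_eq[OF a])
qed

lemma sup_continuous_functional_zero: "sup_continuous_functional M (\<lambda>_. 0) 0"
  by unfold_locales auto

lemma fourier_powi_mult: "fourier (\<lambda>z. z powi k * f z) n = fourier f (n - k)"
  unfolding fourier_eq
  by (intro Bochner_Integration.integral_cong) (auto simp: powi_mult_circle mult.assoc[symmetric])

locale conjugate_exponents =
  fixes p q :: real
  assumes q: "1 < q" "q < 2" and p_eq: "p = q / (q - 1)"
begin

lemma p_gt_2: "2 < p" and pq: "1 < p" "1 < q" "1 / p + 1 / q = 1"
  using q by (auto simp: p_eq field_simps)

lemma fourier_lp: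
  assumes "continuous_on circle f"
  shows "fourier f \<in> lp_space p"
  using p_gt_2 Bessel(1)[OF continuous_on_circle_bounded_measurable[OF assms]] lp_space_mono[of 2 p] by auto

lemma lq_imp_l2: "b \<in> lp_space q \<Longrightarrow> b \<in> lp_space 2"
  using q lp_space_mono[of q 2 b] by simp

lemma A_norm_continuous:
  "continuous_on circle f \<Longrightarrow> A_norm p (function_distribution f) = ennreal (power_sum p (fourier f) powr (1 / p))"
  by (simp add: A_norm_def lp_norm_eq fourier_lp)

text \<open>
  Parseval's formula and Hoelder's inequality.
\<close>

lemma norm_complex_integral_le:
  assumes "finite_complex_measure circle_borel \<mu>" "fourier_coeff (measure_distribution \<mu>) \<in> lp_space q"
    and f: "continuous_on circle f"
  shows "norm (complex_integral circle_borel \<mu> f)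
    \<le> power_sum q (fourier_coeff (measure_distribution \<mu>)) powr (1 / q) * power_sum p (fourier f) powr (1 / p)"
proof -
  let ?m = "fourier_coeff (measure_distribution \<mu>)"
  have "(\<lambda>n. ?m (- n)) \<in> lp_space q" "power_sum q (\<lambda>n. ?m (- n)) = power_sum q ?m"
    using power_sum_reindex[OF bij_uminus_int] assms(2) by auto
  then show ?thesis
    using Holder_inequality[OF pq _ fourier_lp[OF f], of "\<lambda>n. ?m (- n)"]
      complex_integral_eq_pairing[OF assms(1) lq_imp_l2[OF assms(2)] f]
    by (simp add: pairing_def)
qed

end

locale compact_circle_subset = conjugate_exponents p q for p q +
  fixes E :: "complex set"
  assumes compact: "compact E" and subset: "E \<subseteq> circle"
begin

lemma closed: "closed E" by (rule compact_imp_closed[OF compact])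

lemma sets_E: "E \<in> sets circle_borel"
  using subset closed by (simp add: sets_circle_borel_iff)

abbreviation admissible :: "(complex \<Rightarrow> complex) set" where
  "admissible \<equiv> {\<phi>. continuous_on circle \<phi> \<and> (\<forall>z\<in>E. \<phi> z = 1)}"

lemma const_1_admissible: "(\<lambda>_. 1) \<in> admissible" by simp

lemma capacity_finite: "lp_capacity p E < top"
proof -
  have "lp_capacity p E \<le> A_norm p (function_distribution (\<lambda>_. 1))"
    unfolding lp_capacity_def by (intro INF_lower const_1_admissible)
  then show ?thesis by (simp add: A_norm_continuous order_le_less_trans ennreal_less_top)
qed

lemma complex_integral_admissible_mult:
  assumes "\<mu> \<in> measures_on E" "\<phi> \<in> admissible" "continuous_on circle f"
  shows "complex_integral circle_borel \<mu> (\<lambda>z. f z * \<phi> z) = complex_integral circle_borel \<mu> f"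
  using assms by (intro complex_integral_eqI_on_support[OF assms(1) sets_E])
    (auto intro!: continuous_on_circle_bounded_measurable continuous_intros)

text \<open>
  An admissible function agrees with the indicator of \<open>E\<close> on \<open>E\<close>, which
  carries \<open>\<mu>\<close>.
\<close>

lemma complex_integral_admissible:
  assumes \<mu>: "\<mu> \<in> measures_on E" and \<phi>: "\<phi> \<in> admissible"
  shows "complex_integral circle_borel \<mu> \<phi> = \<mu> E"
proof -
  interpret finite_complex_measure circle_borel \<mu> using \<mu> by (rule measures_on_finite_complex)
  have "complex_integral circle_borel \<mu> \<phi> = complex_integral circle_borel \<mu> (indicator E)"
    using \<phi> sets_E by (intro complex_integral_eqI_on_support[OF \<mu> sets_E])
      (auto intro!: continuous_on_circle_bounded_measurable)
  then show ?thesis using sets_E by (simp add: complex_integral_indicator)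
qed

lemma capacity_ge:
  assumes \<nu>: "\<nu> \<in> measures_on E" and n: "A_norm q (measure_distribution \<nu>) \<le> 1"
  shows "ennreal (norm (\<nu> E)) \<le> lp_capacity p E"
  unfolding lp_capacity_def
proof (rule INF_greatest)
  fix \<phi> assume \<phi>: "\<phi> \<in> admissible"
  let ?m = "fourier_coeff (measure_distribution \<nu>)"
  have m: "?m \<in> lp_space q" "power_sum q ?m powr (1 / q) \<le> 1"
    using lp_norm_le_1D[of q ?m] n q by (auto simp: A_norm_def)
  have "norm (\<nu> E) \<le> power_sum q ?m powr (1 / q) * power_sum p (fourier \<phi>) powr (1 / p)"
    using norm_complex_integral_le[OF measures_on_finite_complex[OF \<nu>] m(1), of \<phi>]
      complex_integral_admissible[OF \<nu> \<phi>] \<phi> by simp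
  also have "\<dots> \<le> 1 * power_sum p (fourier \<phi>) powr (1 / p)"
    using m(2) by (intro mult_right_mono) auto
  finally show "ennreal (norm (\<nu> E)) \<le> A_norm p (function_distribution \<phi>)"
    using \<phi> by (simp add: A_norm_continuous ennreal_leI)
qed

text \<open>
  The Fourier transforms of admissible functions form a convex set whose distance from the origin in
  \<open>\<ell>\<^sup>p\<close> is the capacity.
\<close>

lemma separating_sequence:
  obtains b where "b \<in> lp_space q" "power_sum q b \<le> 1"
    "\<And>\<phi>. \<phi> \<in> admissible \<Longrightarrow> enn2real (lp_capacity p E) \<le> Re (pairing b \<phi>)"
proof -
  let ?d = "enn2real (lp_capacity p E)"
  have "\<exists>b\<in>lp_space q. power_sum q b \<le> 1 \<and> (\<forall>v\<in>fourier ` admissible. ?d \<le> Re (\<Sum>\<^sub>\<infinity>n. b n * v n))"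
  proof (rule lp_separation[OF pq])
    show "fourier ` admissible \<noteq> {}" using const_1_admissible by blast
    show "fourier ` admissible \<subseteq> lp_space p" using fourier_lp by auto
    show "0 \<le> ?d" by simp
  next
    fix v u t assume vu: "v \<in> fourier ` admissible" "u \<in> fourier ` admissible" "0 < t" "t < (1::real)"
    then obtain \<phi> \<psi> where \<phi>: "v = fourier \<phi>" "\<phi> \<in> admissible" and \<psi>: "u = fourier \<psi>" "\<psi> \<in> admissible" by auto
    let ?c = "\<lambda>z. of_real (1 - t) * \<phi> z + of_real t * \<psi> z"
    have "?c \<in> admissible" using \<phi> \<psi> by (auto intro!: continuous_intros)
    moreover have "fourier ?c n = of_real (1 - t) * v n + of_real t * u n" for n
    proof -
      have "\<phi> \<in> bounded_measurable circle_borel" "\<psi> \<in> bounded_measurable circle_borel"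
        using \<phi> \<psi> by (auto intro: continuous_on_circle_bounded_measurable)
      then show ?thesis unfolding \<phi>(1) \<psi>(1) by (simp only: fourier_add bounded_measurable_cmult fourier_cmult)
    qed
    ultimately show "(\<lambda>n. of_real (1 - t) * v n + of_real t * u n) \<in> fourier ` admissible"
      by (intro image_eqI[of _ _ ?c]) auto
  next
    fix v assume "v \<in> fourier ` admissible"
    then obtain \<phi> where \<phi>: "v = fourier \<phi>" "\<phi> \<in> admissible" by auto
    have "lp_capacity p E \<le> A_norm p (function_distribution \<phi>)"
      unfolding lp_capacity_def using \<phi> by (intro INF_lower) auto
    also have "\<dots> = ennreal (power_sum p v powr (1 / p))" using \<phi> by (simp add: A_norm_continuous)
    finally have "?d \<le> enn2real (ennreal (power_sum p v powr (1 / p)))"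
      by (intro enn2real_mono) (auto simp: ennreal_less_top)
    then have "?d powr p \<le> (power_sum p v powr (1 / p)) powr p" using p_gt_2 by (intro powr_mono2) auto
    then show "?d powr p \<le> power_sum p v" using p_gt_2 power_sum_nonneg[of p v] by (simp add: powr_powr)
  qed
  then show thesis using that by (auto simp: pairing_def)
qed

text \<open>
  The separating sequence is turned into a measure. Adding any multiple of a continuous function
  that vanishes on \<open>E\<close> preserves admissibility, so the lower bound on the pairing
  forces the pairing with such functions to be zero. Thus the measure lives on \<open>E\<close>, and
  its mass is the pairing with the admissible function \<open>1\<close>.
\<close>

lemma extremal_measure:
  obtains \<nu> where "\<nu> \<in> measures_on E" "A_norm q (measure_distribution \<nu>) \<le> 1"
    "lp_capacity p E \<le> ennreal (norm (\<nu> E))"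
proof -
  let ?d = "enn2real (lp_capacity p E)"
  obtain b where b: "b \<in> lp_space q" "power_sum q b \<le> 1"
    and sep: "\<And>\<phi>. \<phi> \<in> admissible \<Longrightarrow> ?d \<le> Re (pairing b \<phi>)"
    using separating_sequence by blast
  note b2 = lq_imp_l2[OF b(1)]
  interpret P: sup_continuous_functional circle_borel "pairing b" "sqrt (power_sum 2 b)"
    by (rule pairing_functional[OF b2])
  let ?\<nu> = "pairing_measure b"
  interpret finite_complex_measure circle_borel ?\<nu> by (rule finite_complex_measure_pairing_measure[OF b2])
  have annihilates: "pairing b h = 0" if h: "continuous_on circle h" "\<And>z. z \<in> E \<Longrightarrow> h z = 0" for h
  proof (rule ccontr)
    assume w: "pairing b h \<noteq> 0"
    let ?w = "pairing b h" and ?r = "Re (pairing b (\<lambda>_. 1)) - ?d + 1"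
    (* This multiple makes the real part of the pairing with 1 + c * h equal to ?d - 1. *)
    define c where "c = - of_real (?r / norm ?w ^ 2) * cnj ?w"
    have bm: "h \<in> bounded_measurable circle_borel" using h by (intro continuous_on_circle_bounded_measurable)
    have "(\<lambda>z. 1 + c * h z) \<in> admissible" using h by (auto intro!: continuous_intros)
    then have "?d \<le> Re (pairing b (\<lambda>z. 1 + c * h z))" by (rule sep)
    also have "pairing b (\<lambda>z. 1 + c * h z) = pairing b (\<lambda>_. 1) + c * ?w"
      using bm by (simp add: P.add P.cmult bounded_measurable_cmult)
    also have "c * ?w = - of_real ?r"
    proof -
      have "c * ?w = - of_real (?r / norm ?w ^ 2) * (?w * cnj ?w)" by (simp add: c_def)
      also have "\<dots> = - of_real (?r / norm ?w ^ 2 * norm ?w ^ 2)"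
        by (simp only: complex_norm_square[symmetric] of_real_mult mult_minus_left)
      finally show ?thesis using w by simp
    qed
    finally show False by simp
  qed
  have off: "?\<nu> B = 0" if "B \<in> sets circle_borel" "B \<inter> E = {}" for B
    by (rule complex_measure_vanishes_off[OF finite_complex_measure_axioms closed _ that])
      (use subset in \<open>auto simp: complex_integral_pairing_measure[OF b2] continuous_on_circle_bounded_measurable intro!: annihilates\<close>)
  have "measure_support ?\<nu> \<subseteq> E"
  proof
    fix z assume z: "z \<in> measure_support ?\<nu>"
    show "z \<in> E"
    proof (rule ccontr)
      assume "z \<notin> E"
      moreover have "open (- E)" using closed by (rule open_Compl)
      ultimately have "total_variation circle_borel ?\<nu> (- E \<inter> circle) \<noteq> 0"
        using z by (auto simp: measure_support_def)
      moreover have "- E \<inter> circle \<in> sets circle_borel" using closed by (auto simp: sets_circle_borel_iff)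
      ultimately show False using off by (subst (asm) total_variation_eq_0_iff) auto
    qed
  qed
  then have \<nu>: "?\<nu> \<in> measures_on E"
    using complex_measure finite_variation by (simp add: measures_on_def)
  have "A_norm q (measure_distribution ?\<nu>) = ennreal (power_sum q b powr (1 / q))"
    unfolding A_norm_def using power_sum_reindex[OF bij_uminus_int, where a=b and s=q] b(1)
    by (simp add: fourier_coeff_pairing_measure[OF b2, abs_def] lp_norm_eq)
  also have "power_sum q b powr (1 / q) \<le> 1 powr (1 / q)"
    using b q by (intro powr_mono2) (auto simp: power_sum_nonneg)
  finally have n: "A_norm q (measure_distribution ?\<nu>) \<le> 1" by (simp add: ennreal_leI)
  have "?d \<le> Re (pairing b (\<lambda>_. 1))" by (rule sep[OF const_1_admissible])
  also have "pairing b (\<lambda>_. 1) = ?\<nu> E"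
    using complex_integral_admissible[OF \<nu> const_1_admissible] by (simp add: complex_integral_pairing_measure[OF b2])
  also have "Re (?\<nu> E) \<le> norm (?\<nu> E)" by (rule complex_Re_le_cmod)
  finally have "ennreal ?d \<le> ennreal (norm (?\<nu> E))" by (rule ennreal_leI)
  then have "lp_capacity p E \<le> ennreal (norm (?\<nu> E))" using capacity_finite by simp
  with \<nu> n show thesis by (rule that)
qed

theorem capacity_eq_SUP:
  "lp_capacity p E = (SUP \<nu> \<in> {\<nu> \<in> measures_on E. A_norm q (measure_distribution \<nu>) \<le> 1}. ennreal (norm (\<nu> E)))"
proof (rule antisym)
  obtain \<nu> where "\<nu> \<in> measures_on E" "A_norm q (measure_distribution \<nu>) \<le> 1"
    "lp_capacity p E \<le> ennreal (norm (\<nu> E))" using extremal_measure by blast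
  then show "lp_capacity p E \<le> (SUP \<nu> \<in> {\<nu> \<in> measures_on E. A_norm q (measure_distribution \<nu>) \<le> 1}. ennreal (norm (\<nu> E)))"
    by (intro SUP_upper2[of \<nu>]) auto
qed (auto intro!: SUP_least capacity_ge)

text \<open>
  Multiplying an admissible \<open>\<phi>\<close> by \<open>z powi k\<close> shifts its Fourier
  coefficients and keeps their norm, while the integral against \<open>\<mu>\<close> is unchanged if
  \<open>\<phi>\<close> is dropped. So every Fourier coefficient of \<open>\<mu>\<close> is bounded
  by a constant times the norm of \<open>\<phi>\<close>, which can be made arbitrarily small; hence
  all are zero, and so is \<open>\<mu>\<close>. Working with all \<open>k\<close> at once covers
  measures with \<open>\<mu> E = 0\<close>, about which the dual formula for the capacity says
  nothing.
\<close>

lemma capacity_0_imp_measure_0: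
  assumes "lp_capacity p E = 0" and \<mu>: "\<mu> \<in> measures_on E"
    and m: "fourier_coeff (measure_distribution \<mu>) \<in> lp_space q"
  shows "\<not> nonzero_measure \<mu>"
proof -
  interpret finite_complex_measure circle_borel \<mu> using \<mu> by (rule measures_on_finite_complex)
  let ?C = "power_sum q (fourier_coeff (measure_distribution \<mu>)) powr (1 / q)"
  have zero: "complex_integral circle_borel \<mu> (\<lambda>z. z powi k) = 0" for k
  proof -
    have "norm (complex_integral circle_borel \<mu> (\<lambda>z. z powi k)) \<le> 0 + e" if "0 < e" for e
    proof -
      define d where "d = e / (?C + 1)"
      have C: "0 \<le> ?C" by simp
      have d: "0 < d" "?C * d \<le> e"
        using that C by (auto simp: d_def field_simps simp del: powr_ge_zero intro!: divide_pos_pos add_nonneg_pos)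
      have "lp_capacity p E < ennreal d" using assms(1) d by simp
      then obtain \<phi> where \<phi>: "\<phi> \<in> admissible" "A_norm p (function_distribution \<phi>) < ennreal d"
        unfolding lp_capacity_def by (auto simp: INF_less_iff)
      let ?f = "\<lambda>z. z powi k * \<phi> z"
      have f: "continuous_on circle ?f"
        using \<phi>(1) by (auto intro!: continuous_on_mult continuous_on_powi_circle)
      have "bij (\<lambda>n::int. n - k)" by (rule o_bij[of "\<lambda>n. n + k"]) auto
      then have "power_sum p (fourier ?f) = power_sum p (fourier \<phi>)"
        using power_sum_reindex(2)[of "\<lambda>n. n - k" p "fourier \<phi>"] by (simp add: fourier_powi_mult[abs_def])
      then have "power_sum p (fourier ?f) powr (1 / p) \<le> d"
        using \<phi> d by (simp add: A_norm_continuous ennreal_less_iff)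
      then have "?C * power_sum p (fourier ?f) powr (1 / p) \<le> ?C * d" by (intro mult_left_mono) auto
      then show ?thesis
        using norm_complex_integral_le[OF finite_complex_measure_axioms m f] d
          complex_integral_admissible_mult[OF \<mu> \<phi>(1) continuous_on_powi_circle, of k] by simp
    qed
    then have "norm (complex_integral circle_borel \<mu> (\<lambda>z. z powi k)) \<le> 0" by (rule field_le_epsilon)
    then show ?thesis by simp
  qed
  obtain K where K: "sup_continuous_functional circle_borel (complex_integral circle_borel \<mu>) K"
    using complex_integral_functional by blast
  have "complex_integral circle_borel \<mu> f = 0" if "continuous_on circle f" for f
    by (rule sup_continuous_functional_eq_on_monomials[OF K sup_continuous_functional_zero zero that])
  then have "\<mu> B = 0" if "B \<in> sets circle_borel" for B
    using that by (intro complex_measure_vanishes_off[OF finite_complex_measure_axioms closed_empty]) auto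
  then show ?thesis by (auto simp: nonzero_measure_def)
qed

text \<open>
  If no nonzero measure is available, then the extremal measure vanishes, and it dominates the
  capacity.
\<close>

theorem capacity_0_iff:
  "\<not> (\<exists>\<mu> \<in> measures_on E. nonzero_measure \<mu> \<and> fourier_coeff (measure_distribution \<mu>) \<in> lp_space q)
    \<longleftrightarrow> lp_capacity p E = 0"
proof
  assume none: "\<not> (\<exists>\<mu> \<in> measures_on E. nonzero_measure \<mu> \<and> fourier_coeff (measure_distribution \<mu>) \<in> lp_space q)"
  obtain \<nu> where \<nu>: "\<nu> \<in> measures_on E" "A_norm q (measure_distribution \<nu>) \<le> 1"
    "lp_capacity p E \<le> ennreal (norm (\<nu> E))" using extremal_measure by blast
  have "fourier_coeff (measure_distribution \<nu>) \<in> lp_space q"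
    using lp_norm_le_1D(1)[of q] \<nu>(2) q by (simp add: A_norm_def)
  then have "\<nu> E = 0" using none \<nu>(1) sets_E by (auto simp: nonzero_measure_def)
  then show "lp_capacity p E = 0" using \<nu>(3) by simp
qed (use capacity_0_imp_measure_0 in blast)

end

theorem theorem1p3:
  fixes p q :: real and E :: "complex set"
  assumes "1 < q" and "q < 2" and "p = q / (q - 1)"
    and "compact E" and "E \<subseteq> circle"
  shows "(\<not> (\<exists>\<mu> \<in> measures_on E. nonzero_measure \<mu> \<and>
              fourier_coeff (measure_distribution \<mu>) \<in> lp_space q)
            \<longleftrightarrow> lp_capacity p E = 0) \<and>
         lp_capacity p E =
           (SUP \<nu> \<in> {\<nu> \<in> measures_on E. A_norm q (measure_distribution \<nu>) \<le> 1}. ennreal (norm (\<nu> E)))"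
proof -
  interpret compact_circle_subset p q E using assms by unfold_locales
  show ?thesis using capacity_0_iff capacity_eq_SUP by (rule conjI)
qed

end
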